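(* Let $d\ge 1$, let $\Omega\subset\mathbb{R}^d$ be a bounded Lipschitz domain, $0<s<1$, $\alpha=1-2s$, $d_s=2^{1-2s}\Gamma(1-s)/\Gamma(s)$, $f\in L^2(\Omega)$, $\mathcal{D}=\Omega\times(0,\infty)$, and let $\mathcal{I}[w]=\frac12(\nabla w,\nabla w)_{y^\alpha,\mathcal{D}}-d_s\,(f,\mathrm{tr}\{w\})_\Omega$ for $w\in H^{1,\mathrm{b}}_{y^\alpha}(\mathcal{D})$. Consider the problem $$(\mathrm{P})\quad\begin{cases}\nabla\cdot\left(y^\alpha\nabla u(x,y)\right)=0, & (x,y)\in\mathcal{D},\\ -\lim_{y\to0}y^\alpha u_y(x,y)=d_s f(x), & x\in\Omega,\\ u(x,y)=0, & (x,y)\in\partial_L\mathcal{D}:=\partial\Omega\times[0,\infty).\end{cases}$$ If $u\in H^{1,\mathrm{b}}_{y^\alpha}(\mathcal{D})$ solves $(\mathrm{P})$, then $$\mathcal{I}[u]=\min_{w\in H^{1,\mathrm{b}}_{y^\alpha}(\mathcal{D})}\mathcal{I}[w].$$ Conversely, if $u\in H^{1,\mathrm{b}}_{y^\alpha}(\mathcal{D})$ satisfies $\mathcal{I}[u]=\min_{w\in H^{1,\mathrm{b}}_{y^\alpha}(\mathcal{D})}\mathcal{I}[w]$, then $u$ solves $(\mathrm{P})$.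
   Context: Points of $\mathcal{D}$ are written $(x,y)$ with $x\in\Omega$, $y>0$; $\nabla$ is the full gradient in $(x,y)$. For a region $\mathcal{Z}$ and a positive weight $\omega$, $L^2_\omega(\mathcal{Z})$ is the space of $v$ with $\int_{\mathcal{Z}}|v|^2\omega\,dz<\infty$, with inner product $(v_1,v_2)_{\omega,\mathcal{Z}}=\int_{\mathcal{Z}}v_1v_2\,\omega\,dz$ (for vector fields, $v_1v_2$ is replaced by $v_1\cdot v_2$) and norm $\|v\|_{\omega,\mathcal{Z}}$; $\omega$ is omitted from the notation when $\omega\equiv1$. $H^1_\omega(\mathcal{Z})=\{v\in L^2_\omega(\mathcal{Z}):\nabla v\in L^2_\omega(\mathcal{Z})\}$. $H^{1,\mathrm{b}}_{y^\alpha}(\mathcal{D})=\{v\in H^1_{y^\alpha}(\mathcal{D}):\ \lim_{y\to\infty}v(x,y)=0,\ v|_{\partial_L\mathcal{D}}=0\}$, with norm $\|v\|_{H^{1,\mathrm{b}}_{y^\alpha}(\mathcal{D})}=\|\nabla v\|_{y^\alpha,\mathcal{D}}$. For $v$ in this space, $\mathrm{tr}\{v\}(x)=v(x,0)$ denotes its trace on $\Omega\times\{0\}$. Solutions of $(\mathrm{P})$ are understood in the Sobolev weak sense rather than classically: $u\in H^{1,\mathrm{b}}_{y^\alpha}(\mathcal{D})$ solves $(\mathrm{P})$ if $(\nabla u,\nabla w)_{y^\alpha,\mathcal{D}}=d_s\,(f,\mathrm{tr}\{w\})_\Omega$ for all $w\in H^{1,\mathrm{b}}_{y^\alpha}(\mathcal{D})$;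 this is the formulation obtained by integrating by parts in the equation and inserting the Neumann-type condition at $y=0$. *)

theory Defs
  imports "HOL-Analysis.Analysis"
begin

section \<open>Bounded Lipschitz domains\<close>

text \<open>Near each boundary point the domain is the part of a ball lying above the graph of a
  Lipschitz function \<open>g\<close>, in direction \<open>e\<close>; only the values of \<open>g\<close> on the hyperplane
  orthogonal to \<open>e\<close> are used.\<close>

definition bounded_lipschitz_domain :: "'a::euclidean_space set \<Rightarrow> bool" where
  "bounded_lipschitz_domain \<Omega> \<longleftrightarrow>
     open \<Omega> \<and> connected \<Omega> \<and> \<Omega> \<noteq> {} \<and> bounded \<Omega> \<and>
     (\<forall>p \<in> frontier \<Omega>. \<exists>r > 0. \<exists>e. \<exists>g :: 'a \<Rightarrow> real. \<exists>L. norm e = 1 \<and> L-lipschitz_on UNIV g \<and>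
        \<Omega> \<inter> ball p r = {x \<in> ball p r. g (x - (x \<bullet> e) *\<^sub>R e) < x \<bullet> e})"


section \<open>Weighted Lebesgue and Sobolev spaces\<close>

text \<open>Elements of these spaces are functions on the whole type, considered only on \<open>Z\<close> and only up
  to Lebesgue-null sets; all notions below are invariant under changes on null subsets of \<open>Z\<close>.\<close>

definition L2w :: "('z::euclidean_space \<Rightarrow> real) \<Rightarrow> 'z set \<Rightarrow> ('z \<Rightarrow> 'b::euclidean_space) set" where
  "L2w \<omega> Z = {v. v \<in> borel_measurable (lebesgue_on Z) \<and>
                 integrable (lebesgue_on Z) (\<lambda>z. (norm (v z))\<^sup>2 * \<omega> z)}"

definition innerw ::
  "('z::euclidean_space \<Rightarrow> real) \<Rightarrow> 'z set \<Rightarrow> ('z \<Rightarrow> 'b::euclidean_space) \<Rightarrow> ('z \<Rightarrow> 'b) \<Rightarrow> real" where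
  "innerw \<omega> Z v\<^sub>1 v\<^sub>2 = (\<integral>z. (v\<^sub>1 z \<bullet> v\<^sub>2 z) * \<omega> z \<partial>lebesgue_on Z)"

primrec C_k :: "nat \<Rightarrow> ('z::euclidean_space \<Rightarrow> real) \<Rightarrow> bool" where
  "C_k 0 \<phi> \<longleftrightarrow> continuous_on UNIV \<phi>"
| "C_k (Suc k) \<phi> \<longleftrightarrow> \<phi> differentiable_on UNIV \<and>
     (\<forall>b\<in>Basis. C_k k (\<lambda>z. frechet_derivative \<phi> (at z) b))"

definition test_functions :: "'z::euclidean_space set \<Rightarrow> ('z \<Rightarrow> real) set" where
  "test_functions Z = {\<phi>. (\<forall>k. C_k k \<phi>) \<and>
     compact (closure {z. \<phi> z \<noteq> 0}) \<and> closure {z. \<phi> z \<noteq> 0} \<subseteq> Z}"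

definition has_weak_gradient ::
  "'z::euclidean_space set \<Rightarrow> ('z \<Rightarrow> real) \<Rightarrow> ('z \<Rightarrow> 'z) \<Rightarrow> bool" where
  "has_weak_gradient Z v G \<longleftrightarrow>
     (\<forall>K. compact K \<and> K \<subseteq> Z \<longrightarrow> integrable (lebesgue_on K) v \<and> integrable (lebesgue_on K) G) \<and>
     (\<forall>\<phi> \<in> test_functions Z. \<forall>b \<in> Basis.
        (\<integral>z. v z * frechet_derivative \<phi> (at z) b \<partial>lebesgue_on Z) =
        - (\<integral>z. (G z \<bullet> b) * \<phi> z \<partial>lebesgue_on Z))"

text \<open>For open \<open>Z\<close> a weak gradient is unique up to null subsets of \<open>Z\<close>.\<close>

definition weak_gradient :: "'z::euclidean_space set \<Rightarrow> ('z \<Rightarrow> real) \<Rightarrow> ('z \<Rightarrow> 'z)" where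
  "weak_gradient Z v = (SOME G. has_weak_gradient Z v G)"

definition H1w :: "('z::euclidean_space \<Rightarrow> real) \<Rightarrow> 'z set \<Rightarrow> ('z \<Rightarrow> real) set" where
  "H1w \<omega> Z = {v \<in> L2w \<omega> Z. \<exists>G \<in> L2w \<omega> Z. has_weak_gradient Z v G}"


section \<open>Vanishing on a part of the boundary\<close>

text \<open>Sets of zero \<open>k\<close>-dimensional Hausdorff measure. For null sets it makes no
  difference whether the radii of the covering balls are required to be small (\<open>k \<ge> 1\<close>).\<close>

definition hausdorff_null :: "nat \<Rightarrow> 'z::metric_space set \<Rightarrow> bool" where
  "hausdorff_null k N \<longleftrightarrow>
     (\<forall>\<epsilon> > 0. \<exists>(c :: nat \<Rightarrow> 'z) (r :: nat \<Rightarrow> real). (\<forall>i. 0 \<le> r i) \<and> N \<subseteq> (\<Union>i. cball (c i) (r i)) \<and>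
        summable (\<lambda>i. r i ^ k) \<and> (\<Sum>i. r i ^ k) < \<epsilon>)"

text \<open>The boundary value of \<open>v\<close> at a boundary point \<open>p\<close> of \<open>Z\<close> in the sense of traces is the number
  \<open>c\<close> for which the mean of \<open>\<bar>v - c\<bar>\<close> over \<open>Z \<inter> ball p r\<close> tends to zero. On Lipschitz boundaries this
  holds at almost every point (with respect to surface measure) with \<open>c\<close> the value of the Sobolev
  trace of \<open>v\<close>, see Evans and Gariepy, Measure Theory and Fine Properties of Functions, Section 5.3.\<close>

definition boundary_value :: "'z::euclidean_space set \<Rightarrow> ('z \<Rightarrow> real) \<Rightarrow> 'z \<Rightarrow> real \<Rightarrow> bool" where
  "boundary_value Z v p c \<longleftrightarrow>
     ((\<lambda>r. (\<integral>\<^sup>+z \<in> Z \<inter> ball p r. ennreal \<bar>v z - c\<bar> \<partial>lebesgue) / emeasure lebesgue (Z \<inter> ball p r))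
        \<longlongrightarrow> 0) (at_right 0)"

definition vanishes_on_boundary :: "'z::euclidean_space set \<Rightarrow> 'z set \<Rightarrow> ('z \<Rightarrow> real) \<Rightarrow> bool" where
  "vanishes_on_boundary Z S v \<longleftrightarrow> hausdorff_null (DIM('z) - 1) {p \<in> S. \<not> boundary_value Z v p 0}"


section \<open>The half-cylinder\<close>

definition half_cylinder :: "'a set \<Rightarrow> ('a \<times> real) set" where
  "half_cylinder \<Omega> = \<Omega> \<times> {0<..}"

definition lateral_boundary :: "'a::topological_space set \<Rightarrow> ('a \<times> real) set" where
  "lateral_boundary \<Omega> = frontier \<Omega> \<times> {0..}"

definition ypow :: "real \<Rightarrow> 'a \<times> real \<Rightarrow> real" where
  "ypow \<alpha> = (\<lambda>(x, y). y powr \<alpha>)"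

text \<open>Pointwise expressions in \<open>y\<close> (the value at \<open>y = 0\<close>, the limit for \<open>y \<rightarrow> \<infinity>\<close>) refer to the
  representative of \<open>v\<close> which is continuous up to \<open>y = 0\<close> on almost every vertical half-line.
  For \<open>\<bar>\<alpha>\<bar> < 1\<close> it exists for every \<open>v\<close> in the weighted space \<open>H1w (ypow \<alpha>) (half_cylinder \<Omega>)\<close>,
  and on almost every half-line it is unique.\<close>

definition vertical_rep ::
  "'a::euclidean_space set \<Rightarrow> ('a \<times> real \<Rightarrow> real) \<Rightarrow> ('a \<times> real \<Rightarrow> real) \<Rightarrow> bool" where
  "vertical_rep \<Omega> v w \<longleftrightarrow>
     (AE z in lebesgue_on (half_cylinder \<Omega>). w z = v z) \<and>
     (AE x in lebesgue_on \<Omega>. continuous_on {0..} (\<lambda>y. w (x, y)))"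

definition tr :: "'a::euclidean_space set \<Rightarrow> ('a \<times> real \<Rightarrow> real) \<Rightarrow> 'a \<Rightarrow> real" where
  "tr \<Omega> v = (\<lambda>x. (SOME w. vertical_rep \<Omega> v w) (x, 0))"

definition vanishes_at_infinity :: "'a::euclidean_space set \<Rightarrow> ('a \<times> real \<Rightarrow> real) \<Rightarrow> bool" where
  "vanishes_at_infinity \<Omega> v \<longleftrightarrow>
     (\<exists>w. vertical_rep \<Omega> v w \<and> (AE x in lebesgue_on \<Omega>. ((\<lambda>y. w (x, y)) \<longlongrightarrow> 0) at_top))"

definition H1b :: "real \<Rightarrow> 'a::euclidean_space set \<Rightarrow> ('a \<times> real \<Rightarrow> real) set" where
  "H1b \<alpha> \<Omega> = {v \<in> H1w (ypow \<alpha>) (half_cylinder \<Omega>).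
     vanishes_at_infinity \<Omega> v \<and>
     vanishes_on_boundary (half_cylinder \<Omega>) (lateral_boundary \<Omega>) v}"


section \<open>The problem and its energy\<close>

definition d_const :: "real \<Rightarrow> real" where
  "d_const s = 2 powr (1 - 2 * s) * Gamma (1 - s) / Gamma s"

definition grad_form ::
  "real \<Rightarrow> 'a::euclidean_space set \<Rightarrow> ('a \<times> real \<Rightarrow> real) \<Rightarrow> ('a \<times> real \<Rightarrow> real) \<Rightarrow> real" where
  "grad_form \<alpha> \<Omega> v w = innerw (ypow \<alpha>) (half_cylinder \<Omega>)
     (weak_gradient (half_cylinder \<Omega>) v) (weak_gradient (half_cylinder \<Omega>) w)"

definition solves_P ::
  "real \<Rightarrow> 'a::euclidean_space set \<Rightarrow> ('a \<Rightarrow> real) \<Rightarrow> ('a \<times> real \<Rightarrow> real) \<Rightarrow> bool" where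
  "solves_P s \<Omega> f u \<longleftrightarrow> u \<in> H1b (1 - 2 * s) \<Omega> \<and>
     (\<forall>w \<in> H1b (1 - 2 * s) \<Omega>.
        grad_form (1 - 2 * s) \<Omega> u w = d_const s * innerw (\<lambda>_. 1) \<Omega> f (tr \<Omega> w))"

definition energy ::
  "real \<Rightarrow> 'a::euclidean_space set \<Rightarrow> ('a \<Rightarrow> real) \<Rightarrow> ('a \<times> real \<Rightarrow> real) \<Rightarrow> real" where
  "energy s \<Omega> f w = grad_form (1 - 2 * s) \<Omega> w w / 2 - d_const s * innerw (\<lambda>_. 1) \<Omega> f (tr \<Omega> w)"

end

theory Submission
  imports Defs
begin

text \<open>Along a line \<open>u + t w\<close> the energy is a quadratic polynomial in \<open>t\<close>, whose linear
  coefficient is the defect of the weak equation tested with \<open>w\<close> and whose quadratic coefficient is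
  nonnegative; so \<open>u\<close> minimises iff all linear coefficients vanish. Linearity of weak gradients rests
  on their uniqueness, that is, on the fundamental lemma of the calculus of variations. Linearity of
  \<open>w \<mapsto> (f, tr w)\<close> needs \<open>tr w \<in> L\<^sup>2(\<Omega>)\<close>, since the integral of a non-integrable function is \<open>0\<close>.
  To see this, test the weak gradient with products \<open>\<phi>(x) \<psi>(y)\<close>, where \<open>\<psi>\<close> rises from \<open>0\<close> to \<open>1\<close> on
  \<open>[1/n, 2/n]\<close> and falls back to \<open>0\<close> on \<open>[1, 2]\<close>: for almost every \<open>x\<close> this bounds weighted means of
  \<open>w(x, \<cdot>)\<close> over \<open>[1/n, 2/n]\<close>, hence in the limit \<open>\<bar>w(x, 0)\<bar>\<close>, by the integral of
  \<open>C \<bar>w\<bar> + \<bar>\<partial>\<^sub>y w\<bar>\<close> over \<open>{x} \<times> [0, 2]\<close>. As \<open>\<alpha> < 1\<close> makes \<open>y\<^sup>-\<^sup>\<alpha>\<close> integrable near \<open>0\<close>, the Cauchy-Schwarz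
  inequality concludes.\<close>

section \<open>Smooth functions\<close>

text \<open>Both \<open>weak_gradient\<close> and \<open>tr\<close> are picked by
  \<open>SOME\<close>, so they are linear only up to null sets, and only through a uniqueness
  result. For traces that result is a formula: for almost every x, the means of \<open>v\<close>
  against kernels concentrated on [1/n, 2/n] converge to \<open>w (x, 0)\<close> for every
  representative \<open>w\<close> continuous up to y = 0. The formula depends on \<open>v\<close>
  alone, and it also makes the trace measurable. The kernels have to stay away from y = 0, because
  test functions have compact support in the open half-cylinder; so the trace is reached only as a
  limit. The spaces consist of Lebesgue measurable functions, whose restrictions to vertical lines
  need not be measurable; hence each function is replaced by a Borel one before Fubini is applied.
  The fundamental lemma is used a second time, in x alone, to pass from the weak identity to one on
  almost every line; this is done for each n, so that only countably many null sets arise. A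
  continuous representative need not be constructed: the condition at infinity in \<open>H1b\<close>
  provides one.\<close>

lemma C_k_imp_continuous: "C_k k f \<Longrightarrow> continuous_on UNIV f"
  by (cases k) (auto intro: differentiable_imp_continuous_on)

lemma C_k_SucD: "C_k (Suc k) f \<Longrightarrow> C_k k f"
proof (induction k arbitrary: f)
  case 0
  then show ?case by (auto intro: differentiable_imp_continuous_on)
next
  case (Suc k)
  show ?case
    using Suc.prems Suc.IH C_k.simps(2) by blast
qed

lemma C_k_Suc_has_derivative:
  assumes "C_k (Suc k) f"
  shows "(f has_derivative frechet_derivative f (at z)) (at z)"
  using assms by (simp add: frechet_derivative_works differentiable_on_def)

text \<open>Derivatives are unique, so an explicit formula may replace
  \<open>frechet_derivative\<close>. The closure properties below enter their induction through this
  rule.\<close>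

lemma C_k_SucI:
  assumes "\<And>z. (f has_derivative f' z) (at z)"
    and "\<And>b. b \<in> Basis \<Longrightarrow> C_k k (\<lambda>z. f' z b)"
  shows "C_k (Suc k) f"
proof -
  have "frechet_derivative f (at z) = f' z" for z
    using frechet_derivative_at[OF assms(1)] by simp
  then show ?thesis
    using assms by (auto simp: differentiable_on_def differentiable_def)
qed

lemma C_k_const: "C_k k (\<lambda>_. c)"
proof (induction k arbitrary: c)
  case (Suc k)
  then show ?case by (intro C_k_SucI[where f' = "\<lambda>_ _. 0"]) auto
qed simp

lemma C_k_add: "C_k k f \<Longrightarrow> C_k k g \<Longrightarrow> C_k k (\<lambda>z. f z + g z)"
proof (induction k arbitrary: f g)
  case (Suc k)
  show ?case
  proof (rule C_k_SucI)
    show "((\<lambda>z. f z + g z) has_derivative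
        (\<lambda>h. frechet_derivative f (at z) h + frechet_derivative g (at z) h)) (at z)" for z
      by (intro has_derivative_add C_k_Suc_has_derivative[OF Suc.prems(1)]
          C_k_Suc_has_derivative[OF Suc.prems(2)])
  qed (use Suc in auto)
qed (auto intro: continuous_intros)

lemma C_k_mult: "C_k k f \<Longrightarrow> C_k k g \<Longrightarrow> C_k k (\<lambda>z. f z * g z)"
proof (induction k arbitrary: f g)
  case (Suc k)
  show ?case
  proof (rule C_k_SucI)
    show "((\<lambda>z. f z * g z) has_derivative
        (\<lambda>h. f z * frechet_derivative g (at z) h + frechet_derivative f (at z) h * g z)) (at z)" for z
      by (intro has_derivative_mult C_k_Suc_has_derivative[OF Suc.prems(1)]
          C_k_Suc_has_derivative[OF Suc.prems(2)])
    \<comment> \<open>The undifferentiated factors are needed one order below what is given.\<close>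
    show "C_k k (\<lambda>z. f z * frechet_derivative g (at z) b + frechet_derivative f (at z) b * g z)"
      if "b \<in> Basis" for b
      using Suc.prems that
      by (intro C_k_add Suc.IH) (auto intro: C_k_SucD)
  qed
qed (auto intro: continuous_intros)

lemma C_k_sum: "finite I \<Longrightarrow> (\<And>i. i \<in> I \<Longrightarrow> C_k k (f i)) \<Longrightarrow> C_k k (\<lambda>z. \<Sum>i\<in>I. f i z)"
  by (induction I rule: finite_induct) (auto intro: C_k_const C_k_add)

lemma C_k_prod: "finite I \<Longrightarrow> (\<And>i. i \<in> I \<Longrightarrow> C_k k (f i)) \<Longrightarrow> C_k k (\<lambda>z. \<Prod>i\<in>I. f i z)"
  by (induction I rule: finite_induct) (auto intro: C_k_const C_k_mult)

lemma C_k_diff: "C_k k f \<Longrightarrow> C_k k g \<Longrightarrow> C_k k (\<lambda>z. f z - g z)"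
  using C_k_add[of k f "\<lambda>z. (- 1) * g z"] C_k_mult[OF C_k_const, of k g "- 1"] by simp

lemma C_k_inverse:
  assumes "\<And>z. f z \<noteq> 0"
  shows "C_k k f \<Longrightarrow> C_k k (\<lambda>z. inverse (f z))"
proof (induction k)
  case 0
  then show ?case using assms by (auto intro: continuous_intros)
next
  case (Suc k)
  \<comment> \<open>The derivative of the reciprocal contains the reciprocal again, to which the
    induction hypothesis applies at order \<open>k\<close>.\<close>
  then have inv: "C_k k (\<lambda>z. inverse (f z))" by (blast intro: C_k_SucD)
  show ?case
  proof (rule C_k_SucI)
    show "((\<lambda>z. inverse (f z)) has_derivative
        (\<lambda>h. - (inverse (f z) * frechet_derivative f (at z) h * inverse (f z)))) (at z)" for z
      by (intro Deriv.has_derivative_inverse assms C_k_Suc_has_derivative[OF Suc.prems])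
    show "C_k k (\<lambda>z. - (inverse (f z) * frechet_derivative f (at z) b * inverse (f z)))"
      if "b \<in> Basis" for b
      using C_k_mult[OF C_k_const, of k _ "- 1"] C_k_mult[OF C_k_mult[OF inv] inv] Suc.prems that
      by fastforce
  qed
qed

text \<open>\<open>C_k\<close> speaks of derivatives along \<open>Basis\<close> only. This expands a
  derivative in any other direction, such as the image of a basis vector under a linear map.\<close>

lemma linear_sum_Basis:
  fixes L :: "'b::euclidean_space \<Rightarrow> real"
  assumes "linear L"
  shows "L x = (\<Sum>i\<in>Basis. (x \<bullet> i) * L i)"
proof -
  have "L x = L (\<Sum>i\<in>Basis. (x \<bullet> i) *\<^sub>R i)" by (simp add: euclidean_representation)
  also have "\<dots> = (\<Sum>i\<in>Basis. (x \<bullet> i) * L i)"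
    by (simp add: linear_sum[OF assms] linear_scale[OF assms])
  finally show ?thesis .
qed

lemma C_k_compose_affine:
  fixes f :: "'b::euclidean_space \<Rightarrow> real" and A :: "'a::euclidean_space \<Rightarrow> 'b"
  assumes A: "bounded_linear A"
  shows "C_k k f \<Longrightarrow> C_k k (\<lambda>z. f (A z + c))"
proof (induction k arbitrary: f)
  case 0
  have "continuous_on UNIV (\<lambda>z. A z + c)"
    using A by (intro continuous_intros linear_continuous_on)
  with 0 show ?case
    using continuous_on_compose2[of UNIV f UNIV "\<lambda>z. A z + c"] by auto
next
  case (Suc k)
  have lin: "linear (frechet_derivative f (at z))" for z
    using C_k_Suc_has_derivative[OF Suc.prems] has_derivative_linear by blast
  show ?case
  proof (rule C_k_SucI)
    fix z
    have "((\<lambda>z. A z + c) has_derivative A) (at z)"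
      using bounded_linear.has_derivative[OF A has_derivative_ident]
      by (auto intro!: derivative_eq_intros)
    then show "((\<lambda>z. f (A z + c)) has_derivative
        (\<lambda>h. \<Sum>i\<in>Basis. (A h \<bullet> i) * frechet_derivative f (at (A z + c)) i)) (at z)"
      using has_derivative_compose[OF _ C_k_Suc_has_derivative[OF Suc.prems], of "\<lambda>z. A z + c" A z UNIV]
      by (simp add: linear_sum_Basis[OF lin, symmetric])
  next
    show "C_k k (\<lambda>z. \<Sum>i\<in>Basis. (A b \<bullet> i) * frechet_derivative f (at (A z + c)) i)" for b
      using Suc by (intro C_k_sum C_k_mult[OF C_k_const] Suc.IH) auto
  qed
qed

lemma C_k_real_SucI:
  fixes f :: "real \<Rightarrow> real"
  assumes "\<And>x. (f has_real_derivative f' x) (at x)" and "C_k k f'"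
  shows "C_k (Suc k) f"
  by (rule C_k_SucI[where f' = "\<lambda>x h. f' x * h"]) (use assms in \<open>auto simp: has_field_derivative_def\<close>)

text \<open>The factor \<open>x\<^sup>-\<^sup>n\<close> makes this family closed under differentiation up to linear combinations.\<close>

definition exp_recip :: "nat \<Rightarrow> real \<Rightarrow> real" where
  "exp_recip n x = (if 0 < x then (1 / x) ^ n * exp (- (1 / x)) else 0)"

text \<open>Substituting 1/x turns the limit from the right into the decay of x^n / exp x at
  infinity.\<close>

lemma exp_recip_tendsto_0: "(exp_recip n \<longlongrightarrow> 0) (at 0)"
proof (rule filterlim_split_at)
  show "(exp_recip n \<longlongrightarrow> 0) (at_left 0)"
    by (rule tendsto_eventually)
      (auto simp: exp_recip_def eventually_at_filter)
  have "((\<lambda>x::real. x ^ n / exp x) \<longlongrightarrow> 0) at_top"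
    by (rule tendsto_power_div_exp_0)
  from filterlim_compose[OF this filterlim_inverse_at_top_right]
  have "((\<lambda>x::real. inverse x ^ n / exp (inverse x)) \<longlongrightarrow> 0) (at_right 0)" .
  then show "(exp_recip n \<longlongrightarrow> 0) (at_right 0)"
    by (rule Lim_transform_eventually)
      (auto simp: exp_recip_def eventually_at_filter field_simps exp_minus)
qed

lemma has_real_derivative_exp_recip:
  "(exp_recip n has_real_derivative (exp_recip (n + 2) x - real n * exp_recip (n + 1) x)) (at x)"
proof -
  consider "x > 0" | "x < 0" | "x = 0" by linarith
  then show ?thesis
  proof cases
    case 1
    have i: "((\<lambda>x. 1 / x) has_real_derivative - ((1 / x)\<^sup>2)) (at x)"
      using 1 by (auto intro!: derivative_eq_intros simp: power2_eq_square)
    have "((\<lambda>x. exp (- (1 / x))) has_real_derivative exp (- (1 / x)) * (1 / x)\<^sup>2) (at x)"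
      using DERIV_chain2[OF DERIV_exp DERIV_minus[OF i]] by simp
    from DERIV_mult[OF DERIV_power[OF i, of n] this]
    have "((\<lambda>x. (1 / x) ^ n * exp (- (1 / x))) has_real_derivative
        (exp_recip (n + 2) x - real n * exp_recip (n + 1) x)) (at x)"
      by (rule DERIV_cong)
        (use 1 in \<open>cases n; simp add: exp_recip_def algebra_simps power2_eq_square\<close>)
    then show ?thesis
      by (rule DERIV_cong_ev[THEN iffD1, rotated -1])
        (use 1 eventually_nhds_in_open[of "{0<..}" x] in \<open>auto simp: exp_recip_def elim!: eventually_mono\<close>)
  next
    case 2
    have "((\<lambda>x. 0) has_real_derivative (exp_recip (n + 2) x - real n * exp_recip (n + 1) x)) (at x)"
      using 2 by (auto simp: exp_recip_def)
    then show ?thesis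
      by (rule DERIV_cong_ev[THEN iffD1, rotated -1])
        (use 2 eventually_nhds_in_open[of "{..<0}" x] in \<open>auto simp: exp_recip_def elim!: eventually_mono\<close>)
  next
    case 3
    \<comment> \<open>The difference quotient of \<open>exp_recip n\<close> at 0 is
      \<open>exp_recip (Suc n)\<close>, on both sides of 0.\<close>
    have "((\<lambda>h. (exp_recip n (0 + h) - exp_recip n 0) / h) \<longlongrightarrow> 0) (at 0)"
      by (rule Lim_transform_eventually[OF exp_recip_tendsto_0[of "Suc n"]])
        (auto simp: exp_recip_def)
    then show ?thesis
      using 3 by (simp add: DERIV_def exp_recip_def)
  qed
qed

lemma C_k_exp_recip: "C_k k (exp_recip n)"
proof (induction k arbitrary: n)
  case 0
  show ?case
    using has_real_derivative_exp_recip
    by (auto intro!: DERIV_isCont continuous_at_imp_continuous_on)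
next
  case (Suc k)
  show ?case
    by (intro C_k_real_SucI[OF has_real_derivative_exp_recip] C_k_diff C_k_mult[OF C_k_const] Suc)
qed

text \<open>The classical smooth transition from 0 (for x at most 0) to 1 (for x at least 1). The
  denominator is positive because x and 1 - x cannot both be nonpositive.\<close>

definition smooth_step :: "real \<Rightarrow> real" where
  "smooth_step x = exp_recip 0 x * inverse (exp_recip 0 x + exp_recip 0 (1 - x))"

lemma smooth_step_denominator_pos: "exp_recip 0 x + exp_recip 0 (1 - x) > 0"
  by (cases "x > 0") (auto simp: exp_recip_def add_pos_pos)

lemma C_k_smooth_step: "C_k k smooth_step"
proof -
  have "C_k k (\<lambda>x. exp_recip 0 (- x + 1))"
    by (intro C_k_compose_affine C_k_exp_recip bounded_linear_minus bounded_linear_ident)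
  then have "C_k k (\<lambda>x. exp_recip 0 (1 - x))" by simp
  then have "C_k k (\<lambda>x. exp_recip 0 x * inverse (exp_recip 0 x + exp_recip 0 (1 - x)))"
    using smooth_step_denominator_pos
    by (intro C_k_mult C_k_inverse C_k_add C_k_exp_recip) (auto simp: less_le)
  then show ?thesis unfolding smooth_step_def[abs_def] .
qed

lemma smooth_step_eq_0: "x \<le> 0 \<Longrightarrow> smooth_step x = 0"
  by (simp add: smooth_step_def exp_recip_def)

lemma smooth_step_eq_1: "1 \<le> x \<Longrightarrow> smooth_step x = 1"
  by (simp add: smooth_step_def exp_recip_def)

lemma smooth_step_bounds: "0 \<le> smooth_step x" "smooth_step x \<le> 1"
proof -
  have "exp_recip 0 y \<ge> 0" for y by (simp add: exp_recip_def)
  then show "0 \<le> smooth_step x" "smooth_step x \<le> 1"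
    using smooth_step_denominator_pos[of x]
    by (auto simp: smooth_step_def field_simps)
qed

section \<open>The fundamental lemma of the calculus of variations\<close>

lemma test_functionsI:
  assumes "\<And>k. C_k k \<phi>" and "compact K" and "K \<subseteq> Z" and "\<And>z. z \<notin> K \<Longrightarrow> \<phi> z = 0"
  shows "\<phi> \<in> test_functions Z"
proof -
  have sub: "closure {z. \<phi> z \<noteq> 0} \<subseteq> K"
    using assms(2,4) by (intro closure_minimal) (auto simp: compact_imp_closed)
  moreover have "compact (closure {z. \<phi> z \<noteq> 0})"
    using compact_Int_closed[OF assms(2) closed_closure] sub by (metis inf.absorb_iff2)
  ultimately show ?thesis
    using assms by (auto simp: test_functions_def)
qed

lemma bounded_linear_inner_left_scaled: "bounded_linear (\<lambda>z. c * (z \<bullet> i))"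
  by (intro bounded_linear_const_mult bounded_linear_inner_left)

text \<open>Each factor climbs from 0 to 1 within distance 1/n inside a face of the box. So the
  products vanish off the open box, stay between 0 and 1, and are eventually 1 at each interior
  point.\<close>

lemma box_test_function:
  fixes a b :: "'z::euclidean_space"
  assumes "cbox a b \<subseteq> Z"
  defines "\<phi> \<equiv> \<lambda>(n::nat) z. \<Prod>i\<in>Basis. smooth_step (real n * (z \<bullet> i - a \<bullet> i)) * smooth_step (real n * (b \<bullet> i - z \<bullet> i))"
  shows "\<phi> n \<in> test_functions Z"
    and "0 \<le> \<phi> n z" and "\<phi> n z \<le> 1" and "z \<notin> box a b \<Longrightarrow> \<phi> n z = 0"
    and "(\<lambda>n. \<phi> n z) \<longlonglongrightarrow> indicator (box a b) z"
proof -
  show out: "z \<notin> box a b \<Longrightarrow> \<phi> n z = 0" for z n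
  proof -
    assume "z \<notin> box a b"
    then obtain i where i: "i \<in> Basis" "z \<bullet> i \<le> a \<bullet> i \<or> b \<bullet> i \<le> z \<bullet> i"
      by (auto simp: mem_box not_less)
    then have "smooth_step (real n * (z \<bullet> i - a \<bullet> i)) = 0 \<or> smooth_step (real n * (b \<bullet> i - z \<bullet> i)) = 0"
      by (auto simp: mult_nonneg_nonpos intro!: smooth_step_eq_0)
    then show "\<phi> n z = 0"
      using i(1) by (auto simp: \<phi>_def)
  qed
  show "\<phi> n \<in> test_functions Z"
  proof (rule test_functionsI[OF _ compact_cbox assms(1)])
    show "C_k k (\<phi> n)" for k
    proof -
      have "C_k k (\<lambda>z. smooth_step (real n * (z \<bullet> i) + - (real n * (a \<bullet> i))))"
        "C_k k (\<lambda>z. smooth_step (- real n * (z \<bullet> i) + real n * (b \<bullet> i)))" for i :: 'z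
        by (intro C_k_compose_affine[OF bounded_linear_inner_left_scaled] C_k_smooth_step)+
      then show ?thesis
        unfolding \<phi>_def by (intro C_k_prod C_k_mult) (simp_all add: algebra_simps)
    qed
    show "z \<notin> cbox a b \<Longrightarrow> \<phi> n z = 0" for z
      using out box_subset_cbox[of a b] by blast
  qed
  show "0 \<le> \<phi> n z" "\<phi> n z \<le> 1"
    by (auto simp: \<phi>_def smooth_step_bounds intro!: prod_nonneg prod_le_1 mult_le_one)
  show "(\<lambda>n. \<phi> n z) \<longlonglongrightarrow> indicator (box a b) z"
  proof (cases "z \<in> box a b")
    case False
    then show ?thesis by (simp add: out)
  next
    case True
    have ev: "\<forall>\<^sub>F n in sequentially. smooth_step (real n * c) = 1" if "c > 0" for c
    proof -
      have "\<forall>\<^sub>F n in sequentially. real n \<ge> 1 / c"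
        using filterlim_at_top filterlim_real_sequentially by blast
      then show ?thesis
        by eventually_elim (use that in \<open>auto intro!: smooth_step_eq_1 simp: field_simps\<close>)
    qed
    have "\<forall>\<^sub>F n in sequentially. \<forall>i\<in>Basis. smooth_step (real n * (z \<bullet> i - a \<bullet> i)) * smooth_step (real n * (b \<bullet> i - z \<bullet> i)) = 1"
    proof (rule eventually_ball_finite[OF finite_Basis], rule ballI)
      fix i :: 'z assume "i \<in> Basis"
      with True have "z \<bullet> i - a \<bullet> i > 0" "b \<bullet> i - z \<bullet> i > 0"
        by (auto simp: mem_box)
      from this[THEN ev] show "\<forall>\<^sub>F n in sequentially. smooth_step (real n * (z \<bullet> i - a \<bullet> i)) * smooth_step (real n * (b \<bullet> i - z \<bullet> i)) = 1"
        by eventually_elim simp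
    qed
    then have "\<forall>\<^sub>F n in sequentially. \<phi> n z = 1"
      by eventually_elim (simp add: \<phi>_def)
    then show ?thesis
      using True by (simp add: tendsto_eventually)
  qed
qed

lemma test_function_borel_measurable: "\<phi> \<in> test_functions Z \<Longrightarrow> \<phi> \<in> borel_measurable borel"
  unfolding test_functions_def
  using C_k_imp_continuous by (blast intro: borel_measurable_continuous_onI)

text \<open>Open boxes are stable under intersection and generate the Borel sets, so the vanishing
  of the integrals spreads from boxes to all Borel sets. A function with all these integrals zero
  vanishes almost everywhere.\<close>

lemma AE_zero_if_box_integrals_zero:
  fixes g :: "'z::euclidean_space \<Rightarrow> real"
  assumes g: "integrable lebesgue g"
    and box: "\<And>c d. (\<integral>z. indicator (box c d) z * g z \<partial>lebesgue) = 0"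
  shows "AE z in lebesgue. g z = 0"
proof -
  obtain g' where [measurable]: "g' \<in> borel_measurable lborel"
    and eq: "AE z in lborel. g z = g' z"
    using completion_ex_borel_measurable_real[OF borel_measurable_integrable[OF g]] by blast
  have [measurable]: "g \<in> borel_measurable lebesgue" "g' \<in> borel_measurable lebesgue"
    using g by (auto intro: measurable_completion)
  have eq': "AE z in lebesgue. g z = g' z"
    using eq by (rule AE_completion)
  have "integrable lebesgue g'"
    using eq' integrable_cong_AE[of g lebesgue g'] g by simp
  then have g': "integrable lborel g'"
    by (simp add: integrable_completion)
  have box': "(\<integral>z\<in>box c d. g' z \<partial>lborel) = 0" for c d
  proof -
    have "(\<integral>z\<in>box c d. g' z \<partial>lborel) = (\<integral>z. indicator (box c d) z * g' z \<partial>lebesgue)"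
      by (simp add: set_lebesgue_integral_def integral_completion)
    also have "\<dots> = (\<integral>z. indicator (box c d) z * g z \<partial>lebesgue)"
      by (rule integral_cong_AE)
        (use eq' in \<open>auto intro!: borel_measurable_times borel_measurable_indicator\<close>)
    finally show ?thesis using box by simp
  qed
  have si: "set_integrable lborel A g'" if "A \<in> sets borel" for A
    using that g' unfolding set_integrable_def by (intro integrable_mult_indicator) auto
  \<comment> \<open>Passing to complements requires the integral over the whole space, which is
    exhausted by growing boxes.\<close>
  have total: "(\<integral>z. g' z \<partial>lborel) = 0"
  proof -
    have "(\<lambda>n. \<integral>z. indicator (box (- (real n *\<^sub>R One)) (real n *\<^sub>R One)) z *\<^sub>R g' z \<partial>lborel)
        \<longlonglongrightarrow> (\<integral>z. g' z \<partial>lborel)"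
    proof (rule integral_dominated_convergence[where w = "\<lambda>z. \<bar>g' z\<bar>"])
      show "AE z in lborel. (\<lambda>n. indicator (box (- (real n *\<^sub>R One)) (real n *\<^sub>R One)) z *\<^sub>R g' z) \<longlonglongrightarrow> g' z"
      proof (rule AE_I2)
        fix z :: 'z
        have "\<forall>\<^sub>F n in sequentially. real n > norm z"
          using filterlim_at_top_dense filterlim_real_sequentially by blast
        then have "\<forall>\<^sub>F n in sequentially. z \<in> box (- (real n *\<^sub>R One)) (real n *\<^sub>R One)"
        proof eventually_elim
          case (elim n)
          then have "\<bar>z \<bullet> i\<bar> < real n" if "i \<in> Basis" for i
            using Basis_le_norm[OF that, of z] by linarith
          then show ?case by (fastforce simp: mem_box abs_less_iff)
        qed
        then have "\<forall>\<^sub>F n in sequentially. indicator (box (- (real n *\<^sub>R One)) (real n *\<^sub>R One)) z *\<^sub>R g' z = g' z"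
          by eventually_elim simp
        then show "(\<lambda>n. indicator (box (- (real n *\<^sub>R One)) (real n *\<^sub>R One)) z *\<^sub>R g' z) \<longlonglongrightarrow> g' z"
          by (rule tendsto_eventually)
      qed
    qed (use g' in \<open>auto simp: indicator_def\<close>)
    moreover have "(\<integral>z. indicator (box (- (real n *\<^sub>R One)) (real n *\<^sub>R One)) z *\<^sub>R g' z \<partial>lborel) = 0" for n
      using box' unfolding set_lebesgue_integral_def .
    ultimately show ?thesis
      by (simp add: LIMSEQ_const_iff)
  qed
  have "AE z in lborel. g' z = 0"
  proof (rule sigma_finite_measure.density_zero[OF sigma_finite_lborel g'])
    fix A :: "'z set" assume "A \<in> sets lborel"
    have "Int_stable (range (\<lambda>(a, b). box a b :: 'z set))"
      by (auto simp: Int_stable_def box_Int_box)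
    moreover have "range (\<lambda>(a, b). box a b :: 'z set) \<subseteq> Pow UNIV" by auto
    moreover have "A \<in> sigma_sets UNIV (range (\<lambda>(a, b). box a b))"
      using \<open>A \<in> sets lborel\<close> by (simp add: borel_eq_box)
    ultimately show "(\<integral>z\<in>A. g' z \<partial>lborel) = 0"
    proof (induction rule: sigma_sets_induct_disjoint)
      case (basic A)
      then show ?case using box' by auto
    next
      case empty
      then show ?case by (simp add: set_lebesgue_integral_def)
    next
      case (compl A)
      then have A: "A \<in> sets borel" by (simp add: borel_eq_box)
      have "(\<integral>z\<in>UNIV - A. g' z \<partial>lborel) + (\<integral>z\<in>A. g' z \<partial>lborel) = (\<integral>z\<in>(UNIV - A) \<union> A. g' z \<partial>lborel)"
        by (rule set_integral_Un[symmetric]) (use A si in auto)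
      then show ?case
        using compl total by (simp add: set_lebesgue_integral_def)
    next
      case (union F)
      then have F: "F i \<in> sets borel" for i by (simp add: borel_eq_box subset_eq)
      have "(\<integral>z\<in>(\<Union>i. F i). g' z \<partial>lborel) = (\<Sum>i. (\<integral>z\<in>F i. g' z \<partial>lborel))"
        by (rule lebesgue_integral_countable_add)
          (use F si union in \<open>auto simp: disjoint_family_on_def\<close>)
      then show ?case using union by simp
    qed
  qed
  then have "AE z in lebesgue. g' z = 0" by (rule AE_completion)
  with eq' show ?thesis by eventually_elim simp
qed

text \<open>As \<open>h\<close> is only locally integrable, the argument runs on one closed box
  inside \<open>Z\<close> at a time. Smooth approximations of the indicator, dominated there by the
  absolute value of \<open>h\<close>, show that the integral over every such box vanishes. Countably
  many closed boxes cover \<open>Z\<close>.\<close>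

lemma fundamental_lemma_calculus_of_variations:
  fixes h :: "'z::euclidean_space \<Rightarrow> real"
  assumes Z: "open Z"
    and int: "\<And>K. compact K \<Longrightarrow> K \<subseteq> Z \<Longrightarrow> integrable (lebesgue_on K) h"
    and zero: "\<And>\<phi>. \<phi> \<in> test_functions Z \<Longrightarrow> (\<integral>z. h z * \<phi> z \<partial>lebesgue_on Z) = 0"
  shows "AE z in lebesgue_on Z. h z = 0"
proof -
  have [simp, measurable]: "Z \<in> sets lebesgue" using Z by (simp add: borel_open sets_completionI_sets)
  have int': "integrable lebesgue (\<lambda>z. indicator (cbox a b) z * h z)" if "cbox a b \<subseteq> Z" for a b
    using int[OF compact_cbox that] by (simp add: integrable_restrict_space)
  have box: "(\<integral>z. indicator (box a b) z * h z \<partial>lebesgue) = 0" if ab: "cbox a b \<subseteq> Z" for a b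
  proof -
    define \<phi> where "\<phi> n z = (\<Prod>i\<in>Basis. smooth_step (real n * (z \<bullet> i - a \<bullet> i)) * smooth_step (real n * (b \<bullet> i - z \<bullet> i)))"
      for n :: nat and z
    note \<phi> = box_test_function[OF ab, folded \<phi>_def]
    have h: "(\<lambda>z. indicator (cbox a b) z * h z) \<in> borel_measurable lebesgue"
      using int'[OF ab] by auto
    have \<phi>_meas: "\<phi> n \<in> borel_measurable lebesgue" for n
      using test_function_borel_measurable[OF \<phi>(1)] by (auto intro!: measurable_completion)
    have eq: "\<phi> n z * (indicator (cbox a b) z * h z) = indicator Z z * (h z * \<phi> n z)" for n z
      using \<phi>(4)[of z n] ab box_subset_cbox[of a b] by (cases "z \<in> box a b") (auto simp: indicator_def)
    have "(\<lambda>n. \<integral>z. \<phi> n z * (indicator (cbox a b) z * h z) \<partial>lebesgue)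
      \<longlonglongrightarrow> (\<integral>z. indicator (box a b) z * (indicator (cbox a b) z * h z) \<partial>lebesgue)"
    proof (rule integral_dominated_convergence[where w = "\<lambda>z. norm (indicator (cbox a b) z * h z)"])
      show "AE z in lebesgue. (\<lambda>n. \<phi> n z * (indicator (cbox a b) z * h z)) \<longlonglongrightarrow> indicator (box a b) z * (indicator (cbox a b) z * h z)"
        by (intro AE_I2 tendsto_mult \<phi>(5) tendsto_const)
      show "AE z in lebesgue. norm (\<phi> n z * (indicator (cbox a b) z * h z)) \<le> norm (indicator (cbox a b) z * h z)" for n
        using \<phi>(2,3)[of n] by (intro AE_I2) (simp add: abs_mult mult_left_le_one_le)
      show "integrable lebesgue (\<lambda>z. norm (indicator (cbox a b) z * h z))"
        using int'[OF ab] by (rule integrable_norm)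
    qed (use h \<phi>_meas in \<open>auto intro!: borel_measurable_times borel_measurable_indicator\<close>)
    moreover have "(\<integral>z. \<phi> n z * (indicator (cbox a b) z * h z) \<partial>lebesgue) = 0" for n
      using zero[OF \<phi>(1)] by (simp add: eq integral_restrict_space)
    moreover have "indicator (box a b) z * (indicator (cbox a b) z * h z) = indicator (box a b) z * h z" for z
      using box_subset_cbox[of a b] by (auto simp: indicator_def)
    ultimately show ?thesis
      by (simp add: LIMSEQ_const_iff)
  qed
  have cbox: "AE z in lebesgue. z \<in> cbox a b \<longrightarrow> h z = 0" if ab: "cbox a b \<subseteq> Z" for a b
  proof -
    \<comment> \<open>The approximations see the open box only; its frontier is a null set.\<close>
    have fr: "AE z in lebesgue. z \<notin> cbox a b - box a b"
      using negligible_frontier_interval[of a b] unfolding negligible_iff_null_sets by (rule AE_not_in)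
    have "AE z in lebesgue. indicator (cbox a b) z * h z = 0"
    proof (rule AE_zero_if_box_integrals_zero[OF int'[OF ab]])
      fix c d :: 'z
      \<comment> \<open>Both intersections have the same corners, the componentwise maxima and
        minima, so the closed box \<open>cbox e g\<close> still lies in \<open>Z\<close>.\<close>
      obtain e g where eg: "box c d \<inter> box a b = box e g" "cbox c d \<inter> cbox a b = cbox e g"
        using box_Int_box[of c d a b] Int_interval[of c d a b] by blast
      have "(\<integral>z. indicator (box c d) z * (indicator (cbox a b) z * h z) \<partial>lebesgue)
        = (\<integral>z. indicator (box e g) z * h z \<partial>lebesgue)"
      proof (rule integral_cong_AE)
        show "AE z in lebesgue. indicator (box c d) z * (indicator (cbox a b) z * h z) = indicator (box e g) z * h z"
          using fr box_subset_cbox[of a b] unfolding eg(1)[symmetric]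
          by (auto simp: indicator_def elim!: eventually_mono)
        have h: "(\<lambda>z. indicator (cbox a b) z * h z) \<in> borel_measurable lebesgue"
          using int'[OF ab] by auto
        then show "(\<lambda>z. indicator (box c d) z * (indicator (cbox a b) z * h z)) \<in> borel_measurable lebesgue"
          by (rule borel_measurable_times[OF borel_measurable_indicator, rotated]) simp
        have "(\<lambda>z. indicator (box e g) z * (indicator (cbox a b) z * h z)) \<in> borel_measurable lebesgue"
          by (rule borel_measurable_times[OF borel_measurable_indicator h]) simp
        moreover have "indicator (box e g) z * (indicator (cbox a b) z * h z) = indicator (box e g) z * h z" for z
          using box_subset_cbox[of e g] eg by (auto simp: indicator_def)
        ultimately show "(\<lambda>z. indicator (box e g) z * h z) \<in> borel_measurable lebesgue" by simp
      qed
      also have "\<dots> = 0"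
        by (rule box) (use eg ab in blast)
      finally show "(\<integral>z. indicator (box c d) z * (indicator (cbox a b) z * h z) \<partial>lebesgue) = 0" .
    qed
    then show ?thesis by eventually_elim auto
  qed
  obtain \<D> where \<D>: "countable \<D>" "\<D> \<subseteq> Pow Z" "\<forall>X\<in>\<D>. \<exists>a b. X = cbox a b" "\<Union>\<D> = Z"
    using open_countable_Union_open_cbox[OF Z, of thesis] by blast
  have "AE z in lebesgue. \<forall>X\<in>\<D>. z \<in> X \<longrightarrow> h z = 0"
    unfolding AE_ball_countable[OF \<D>(1)]
  proof
    fix X assume X: "X \<in> \<D>"
    with \<D>(3) obtain a b where "X = cbox a b" by blast
    with \<D>(2) X cbox[of a b] show "AE z in lebesgue. z \<in> X \<longrightarrow> h z = 0" by blast
  qed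
  then have "AE z in lebesgue. z \<in> Z \<longrightarrow> h z = 0"
    by eventually_elim (use \<D>(4) in blast)
  then show ?thesis by (simp add: AE_restrict_space_iff)
qed

section \<open>Weak gradients and weighted spaces\<close>

lemma lebesgue_open: "open Z \<Longrightarrow> Z \<in> sets lebesgue"
  by (simp add: borel_open sets_completionI_sets)

lemma test_function_support:
  fixes \<phi> :: "'z::euclidean_space \<Rightarrow> real"
  assumes "\<phi> \<in> test_functions Z"
  obtains K where "compact K" "K \<subseteq> Z" "continuous_on UNIV \<phi>" "\<And>z. z \<notin> K \<Longrightarrow> \<phi> z = 0"
    "\<And>b. b \<in> Basis \<Longrightarrow> continuous_on UNIV (\<lambda>z. frechet_derivative \<phi> (at z) b)"
    "\<And>z b. z \<notin> K \<Longrightarrow> frechet_derivative \<phi> (at z) b = 0"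
proof
  let ?K = "closure {z. \<phi> z \<noteq> 0}"
  show "compact ?K" "?K \<subseteq> Z" using assms by (auto simp: test_functions_def)
  have C: "C_k k \<phi>" for k using assms by (simp add: test_functions_def)
  show "continuous_on UNIV \<phi>" using C by (rule C_k_imp_continuous)
  have C_k_partial: "\<forall>b\<in>Basis. continuous_on UNIV (\<lambda>z. frechet_derivative \<phi> (at z) b)"
    using C[of "Suc 0"] by simp
  show "continuous_on UNIV (\<lambda>z. frechet_derivative \<phi> (at z) b)" if "b \<in> Basis" for b
    using C_k_partial that by blast
  show out: "z \<notin> ?K \<Longrightarrow> \<phi> z = 0" for z
    using closure_subset[of "{z. \<phi> z \<noteq> 0}"] by blast
  show "frechet_derivative \<phi> (at z) b = 0" if "z \<notin> ?K" for z b
  proof -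
    have "((\<lambda>_. 0) has_derivative (\<lambda>_. 0)) (at z)" by simp
    then have "(\<phi> has_derivative (\<lambda>_. 0)) (at z)"
    proof (rule has_derivative_transform_within_open[where s = "- ?K"])
      show "open (- ?K)" by (intro open_Compl closed_closure)
      show "z \<in> - ?K" using that by blast
      show "0 = \<phi> x" if "x \<in> - ?K" for x
        using out[of x] that by (metis ComplD)
    qed
    then show ?thesis using frechet_derivative_at by metis
  qed
qed

text \<open>The factor \<open>\<psi>\<close> has to vanish only on the part of \<open>Z\<close>
  outside \<open>K\<close>. This admits functions of the last coordinate alone, whose support is not
  compact, when \<open>Z\<close> is a cylinder over a compact set.\<close>

lemma integrable_mult_compact_support:
  fixes g \<psi> :: "'z::euclidean_space \<Rightarrow> real"
  assumes g: "integrable (lebesgue_on K) g" and K: "compact K" "K \<subseteq> Z" and Z: "Z \<in> sets lebesgue"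
    and \<psi>: "continuous_on UNIV \<psi>" "\<And>z. z \<in> Z \<Longrightarrow> z \<notin> K \<Longrightarrow> \<psi> z = 0"
  shows "integrable (lebesgue_on Z) (\<lambda>z. g z * \<psi> z)"
proof -
  have "bounded (\<psi> ` K)"
    using \<psi>(1) K by (intro compact_imp_bounded compact_continuous_image) (auto intro: continuous_on_subset)
  then obtain C where C: "\<And>z. z \<in> K \<Longrightarrow> \<bar>\<psi> z\<bar> \<le> C" by (auto simp: bounded_iff)
  have Kl: "K \<in> sets lebesgue" using K by (simp add: borel_compact sets_completionI_sets)
  have gK: "integrable lebesgue (\<lambda>z. indicator K z * g z)"
    using g Kl by (simp add: integrable_restrict_space)
  have "\<psi> \<in> borel_measurable lebesgue"
    using \<psi>(1) by (intro measurable_completion) (auto intro: borel_measurable_continuous_onI)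
  then have m: "(\<lambda>z. \<psi> z * (indicator K z * g z)) \<in> borel_measurable lebesgue"
    by (rule borel_measurable_times) (rule borel_measurable_integrable[OF gK])
  have "integrable lebesgue (\<lambda>z. \<psi> z * (indicator K z * g z))"
  proof (rule Bochner_Integration.integrable_bound[OF integrable_mult_right[OF gK, of C] m])
    show "AE z in lebesgue. norm (\<psi> z * (indicator K z * g z)) \<le> norm (C * (indicator K z * g z))"
    proof (rule AE_I2)
      fix z
      show "norm (\<psi> z * (indicator K z * g z)) \<le> norm (C * (indicator K z * g z))"
        using C[of z] by (cases "z \<in> K") (auto simp: abs_mult intro!: mult_right_mono)
    qed
  qed
  also have "(\<lambda>z. \<psi> z * (indicator K z * g z)) = (\<lambda>z. indicator Z z *\<^sub>R (g z * \<psi> z))"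
    using K(2) \<psi>(2) by (auto simp: indicator_def fun_eq_iff)
  finally show ?thesis
    using Z by (simp add: integrable_restrict_space)
qed

text \<open>The integral of a non-integrable function is 0 by convention, so the identity defining
  weak gradients can be added and subtracted only once its two sides are known to be
  integrable.\<close>

lemma has_weak_gradient_integrable:
  fixes Z :: "'z::euclidean_space set"
  assumes "has_weak_gradient Z v G" and "\<phi> \<in> test_functions Z" and "b \<in> Basis" and "Z \<in> sets lebesgue"
  shows "integrable (lebesgue_on Z) (\<lambda>z. v z * frechet_derivative \<phi> (at z) b)"
    and "integrable (lebesgue_on Z) (\<lambda>z. (G z \<bullet> b) * \<phi> z)"
proof -
  obtain K where K: "compact K" "K \<subseteq> Z" "continuous_on UNIV \<phi>" "\<And>z. z \<notin> K \<Longrightarrow> \<phi> z = 0"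
    "\<And>b. b \<in> Basis \<Longrightarrow> continuous_on UNIV (\<lambda>z. frechet_derivative \<phi> (at z) b)"
    "\<And>z b. z \<notin> K \<Longrightarrow> frechet_derivative \<phi> (at z) b = 0"
    using test_function_support[OF assms(2)] by blast
  have "integrable (lebesgue_on K) v" "integrable (lebesgue_on K) (\<lambda>z. G z \<bullet> b)"
    using assms(1) K(1,2) by (auto simp: has_weak_gradient_def)
  then show "integrable (lebesgue_on Z) (\<lambda>z. v z * frechet_derivative \<phi> (at z) b)"
    "integrable (lebesgue_on Z) (\<lambda>z. (G z \<bullet> b) * \<phi> z)"
    using K assms(3,4) by (auto intro!: integrable_mult_compact_support[where K = K])
qed

lemma has_weak_gradient_add_scaleR:
  assumes "has_weak_gradient Z v G" and "has_weak_gradient Z w H" and Z: "Z \<in> sets lebesgue"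
  shows "has_weak_gradient Z (\<lambda>z. v z + t * w z) (\<lambda>z. G z + t *\<^sub>R H z)"
  unfolding has_weak_gradient_def
proof (intro conjI allI impI ballI)
  fix K assume "compact K \<and> K \<subseteq> Z"
  with assms(1,2) show "integrable (lebesgue_on K) (\<lambda>z. v z + t * w z)"
    "integrable (lebesgue_on K) (\<lambda>z. G z + t *\<^sub>R H z)"
    by (auto simp: has_weak_gradient_def)
next
  fix \<phi> b assume \<phi>: "\<phi> \<in> test_functions Z" and b: "b \<in> (Basis :: 'a set)"
  note int = has_weak_gradient_integrable[OF assms(1) \<phi> b Z] has_weak_gradient_integrable[OF assms(2) \<phi> b Z]
  have "(\<integral>z. (v z + t * w z) * frechet_derivative \<phi> (at z) b \<partial>lebesgue_on Z)
    = (\<integral>z. v z * frechet_derivative \<phi> (at z) b \<partial>lebesgue_on Z)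
      + t * (\<integral>z. w z * frechet_derivative \<phi> (at z) b \<partial>lebesgue_on Z)"
    using int by (simp add: distrib_right mult.assoc)
  also have "\<dots> = - (\<integral>z. (G z \<bullet> b) * \<phi> z \<partial>lebesgue_on Z) - t * (\<integral>z. (H z \<bullet> b) * \<phi> z \<partial>lebesgue_on Z)"
    using assms(1,2) \<phi> b by (simp add: has_weak_gradient_def)
  also have "\<dots> = - (\<integral>z. ((G z + t *\<^sub>R H z) \<bullet> b) * \<phi> z \<partial>lebesgue_on Z)"
    using int by (simp add: inner_add_left distrib_right mult.assoc)
  finally show "(\<integral>z. (v z + t * w z) * frechet_derivative \<phi> (at z) b \<partial>lebesgue_on Z)
    = - (\<integral>z. ((G z + t *\<^sub>R H z) \<bullet> b) * \<phi> z \<partial>lebesgue_on Z)" .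
qed

lemma has_weak_gradient_unique:
  fixes Z :: "'z::euclidean_space set"
  assumes "open Z" and "has_weak_gradient Z v G" and "has_weak_gradient Z v H"
  shows "AE z in lebesgue_on Z. G z = H z"
proof -
  note Z = lebesgue_open[OF assms(1)]
  have "AE z in lebesgue_on Z. (G z - H z) \<bullet> b = 0" if b: "b \<in> Basis" for b
  proof (rule fundamental_lemma_calculus_of_variations[OF assms(1)])
    show "integrable (lebesgue_on K) (\<lambda>z. (G z - H z) \<bullet> b)" if "compact K" "K \<subseteq> Z" for K
      using that assms(2,3) by (auto simp: has_weak_gradient_def)
    show "(\<integral>z. ((G z - H z) \<bullet> b) * \<phi> z \<partial>lebesgue_on Z) = 0" if \<phi>: "\<phi> \<in> test_functions Z" for \<phi>
    proof -
      note int = has_weak_gradient_integrable(2)[OF assms(2) \<phi> b Z] has_weak_gradient_integrable(2)[OF assms(3) \<phi> b Z]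
      have "- (\<integral>z. (G z \<bullet> b) * \<phi> z \<partial>lebesgue_on Z) = - (\<integral>z. (H z \<bullet> b) * \<phi> z \<partial>lebesgue_on Z)"
        using assms(2,3)[unfolded has_weak_gradient_def, THEN conjunct2, THEN bspec, OF \<phi>, THEN bspec, OF b]
        by simp
      then show ?thesis
        using int by (simp add: inner_diff_left left_diff_distrib)
    qed
  qed
  then have "AE z in lebesgue_on Z. \<forall>b\<in>Basis. (G z - H z) \<bullet> b = 0"
    by (simp add: AE_ball_countable countable_finite)
  then show ?thesis
    by eventually_elim (simp add: euclidean_eq_iff[of "G _"] inner_diff_left)
qed

section \<open>Weighted L2 spaces: invariance under null sets, bilinearity, gradients\<close>

text \<open>Lebesgue measure is complete. This provides measurability for objects picked by
  \<open>SOME\<close>, namely weak gradients and traces.\<close>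

lemma borel_measurable_lebesgue_on_AE:
  fixes f :: "'z::euclidean_space \<Rightarrow> 'b::euclidean_space"
  assumes "Z \<in> sets lebesgue" and "f \<in> borel_measurable (lebesgue_on Z)"
    and "AE z in lebesgue_on Z. f z = g z"
  shows "g \<in> borel_measurable (lebesgue_on Z)"
proof -
  have "AE z in lebesgue. (if z \<in> Z then f z else 0) = (if z \<in> Z then g z else 0)"
    using assms(1,3) by (auto simp: AE_restrict_space_iff elim!: eventually_mono)
  from borel_measurable_AE[OF borel_measurable_if_I[OF assms(2,1)] this]
  show ?thesis by (rule borel_measurable_if_D)
qed

lemma L2w_cong_AE:
  assumes "Z \<in> sets lebesgue" and "f \<in> L2w \<omega> Z" and eq: "AE z in lebesgue_on Z. f z = g z"
    and \<omega>: "\<omega> \<in> borel_measurable (lebesgue_on Z)"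
  shows "g \<in> L2w \<omega> Z"
proof -
  have g [measurable]: "g \<in> borel_measurable (lebesgue_on Z)"
    using assms by (auto simp: L2w_def intro: borel_measurable_lebesgue_on_AE)
  have f [measurable]: "f \<in> borel_measurable (lebesgue_on Z)"
    using assms(2) by (simp add: L2w_def)
  note [measurable] = \<omega>
  have "integrable (lebesgue_on Z) (\<lambda>z. (norm (f z))\<^sup>2 * \<omega> z)"
    using assms(2) by (simp add: L2w_def)
  then have "integrable (lebesgue_on Z) (\<lambda>z. (norm (g z))\<^sup>2 * \<omega> z)"
    by (rule integrable_cong_AE_imp) (use eq in auto)
  then show ?thesis using g by (simp add: L2w_def)
qed

lemma L2w_integrable_inner:
  fixes v w :: "'z::euclidean_space \<Rightarrow> 'b::euclidean_space"
  assumes v: "v \<in> L2w \<omega> Z" and w: "w \<in> L2w \<omega> Z"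
    and \<omega>: "\<omega> \<in> borel_measurable (lebesgue_on Z)" "\<And>z. 0 \<le> \<omega> z"
  shows "integrable (lebesgue_on Z) (\<lambda>z. (v z \<bullet> w z) * \<omega> z)"
proof (rule Bochner_Integration.integrable_bound)
  show "integrable (lebesgue_on Z) (\<lambda>z. (norm (v z))\<^sup>2 * \<omega> z + (norm (w z))\<^sup>2 * \<omega> z)"
    using v w by (auto simp: L2w_def)
  have [measurable]: "v \<in> borel_measurable (lebesgue_on Z)" "w \<in> borel_measurable (lebesgue_on Z)"
    using v w by (auto simp: L2w_def)
  note [measurable] = \<omega>(1)
  show "(\<lambda>z. (v z \<bullet> w z) * \<omega> z) \<in> borel_measurable (lebesgue_on Z)" by measurable
  have "\<bar>x \<bullet> y\<bar> \<le> (norm x)\<^sup>2 + (norm y)\<^sup>2" for x y :: 'b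
    using Cauchy_Schwarz_ineq2[of x y] sum_squares_bound[of "norm x" "norm y"]
      mult_nonneg_nonneg[of "norm x" "norm y"] by simp
  then show "AE z in lebesgue_on Z. norm ((v z \<bullet> w z) * \<omega> z) \<le> norm ((norm (v z))\<^sup>2 * \<omega> z + (norm (w z))\<^sup>2 * \<omega> z)"
    using \<omega>(2) by (auto simp: abs_mult distrib_right[symmetric] intro!: mult_right_mono)
qed

lemma norm_add_scaleR_power2:
  fixes x y :: "'b::real_inner"
  shows "(norm (x + t *\<^sub>R y))\<^sup>2 = x \<bullet> x + 2 * t * (x \<bullet> y) + t\<^sup>2 * (y \<bullet> y)"
  unfolding power2_norm_eq_inner
  by (simp add: inner_add_left inner_add_right inner_commute[of y x] power2_eq_square algebra_simps)

lemma L2w_add_scaleR: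
  fixes v w :: "'z::euclidean_space \<Rightarrow> 'b::euclidean_space"
  assumes v: "v \<in> L2w \<omega> Z" and w: "w \<in> L2w \<omega> Z"
    and \<omega>: "\<omega> \<in> borel_measurable (lebesgue_on Z)" "\<And>z. 0 \<le> \<omega> z"
  shows "(\<lambda>z. v z + t *\<^sub>R w z) \<in> L2w \<omega> Z"
proof -
  have [measurable]: "v \<in> borel_measurable (lebesgue_on Z)" "w \<in> borel_measurable (lebesgue_on Z)"
    using v w by (auto simp: L2w_def)
  have "integrable (lebesgue_on Z) (\<lambda>z. (v z \<bullet> v z) * \<omega> z + 2 * t * ((v z \<bullet> w z) * \<omega> z) + t\<^sup>2 * ((w z \<bullet> w z) * \<omega> z))"
    by (intro Bochner_Integration.integrable_add integrable_mult_right L2w_integrable_inner v w \<omega>)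
  then have "integrable (lebesgue_on Z) (\<lambda>z. (norm (v z + t *\<^sub>R w z))\<^sup>2 * \<omega> z)"
    by (simp add: norm_add_scaleR_power2 algebra_simps)
  then show ?thesis by (simp add: L2w_def)
qed

lemma innerw_add_scaleR_self:
  fixes v w :: "'z::euclidean_space \<Rightarrow> 'b::euclidean_space"
  assumes v: "v \<in> L2w \<omega> Z" and w: "w \<in> L2w \<omega> Z"
    and \<omega>: "\<omega> \<in> borel_measurable (lebesgue_on Z)" "\<And>z. 0 \<le> \<omega> z"
  shows "innerw \<omega> Z (\<lambda>z. v z + t *\<^sub>R w z) (\<lambda>z. v z + t *\<^sub>R w z)
    = innerw \<omega> Z v v + 2 * t * innerw \<omega> Z v w + t\<^sup>2 * innerw \<omega> Z w w"
proof -
  have "innerw \<omega> Z (\<lambda>z. v z + t *\<^sub>R w z) (\<lambda>z. v z + t *\<^sub>R w z)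
    = (\<integral>z. (v z \<bullet> v z) * \<omega> z + 2 * t * ((v z \<bullet> w z) * \<omega> z) + t\<^sup>2 * ((w z \<bullet> w z) * \<omega> z) \<partial>lebesgue_on Z)"
    unfolding innerw_def power2_norm_eq_inner[symmetric, of "v _ + t *\<^sub>R w _"] norm_add_scaleR_power2
    by (simp add: algebra_simps)
  also have "\<dots> = innerw \<omega> Z v v + 2 * t * innerw \<omega> Z v w + t\<^sup>2 * innerw \<omega> Z w w"
    using L2w_integrable_inner[OF v v \<omega>] L2w_integrable_inner[OF v w \<omega>] L2w_integrable_inner[OF w w \<omega>]
    by (simp add: innerw_def)
  finally show ?thesis .
qed

lemma innerw_cong_AE:
  assumes "v \<in> L2w \<omega> Z" "v' \<in> L2w \<omega> Z" "w \<in> L2w \<omega> Z" "w' \<in> L2w \<omega> Z"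
    and \<omega>: "\<omega> \<in> borel_measurable (lebesgue_on Z)"
    and "AE z in lebesgue_on Z. v z = v' z" "AE z in lebesgue_on Z. w z = w' z"
  shows "innerw \<omega> Z v w = innerw \<omega> Z v' w'"
proof -
  have [measurable]: "v \<in> borel_measurable (lebesgue_on Z)" "w \<in> borel_measurable (lebesgue_on Z)"
    "v' \<in> borel_measurable (lebesgue_on Z)" "w' \<in> borel_measurable (lebesgue_on Z)"
    using assms by (auto simp: L2w_def)
  note [measurable] = \<omega>
  show ?thesis
    unfolding innerw_def by (rule integral_cong_AE) (use assms(6,7) in auto)
qed

text \<open>The weak gradient picked by \<open>SOME\<close> may differ from the one known to be
  square integrable. By uniqueness the two agree almost everywhere, and the weighted space does not
  notice the difference.\<close>

lemma H1w_weak_gradient: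
  assumes "v \<in> H1w \<omega> Z" and "open Z" and "\<omega> \<in> borel_measurable (lebesgue_on Z)"
  shows "has_weak_gradient Z v (weak_gradient Z v)" and "weak_gradient Z v \<in> L2w \<omega> Z"
proof -
  obtain G where G: "G \<in> L2w \<omega> Z" "has_weak_gradient Z v G"
    using assms(1) by (auto simp: H1w_def)
  show wg: "has_weak_gradient Z v (weak_gradient Z v)"
    unfolding weak_gradient_def by (rule someI[of "has_weak_gradient Z v", OF G(2)])
  show "weak_gradient Z v \<in> L2w \<omega> Z"
    using has_weak_gradient_unique[OF assms(2) G(2) wg] lebesgue_open[OF assms(2)] G(1) assms(3)
    by (blast intro: L2w_cong_AE)
qed

lemma H1w_add_mult:
  assumes v: "v \<in> H1w \<omega> Z" and w: "w \<in> H1w \<omega> Z" and Z: "open Z"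
    and \<omega>: "\<omega> \<in> borel_measurable (lebesgue_on Z)" "\<And>z. 0 \<le> \<omega> z"
  shows "(\<lambda>z. v z + t * w z) \<in> H1w \<omega> Z"
    and "AE z in lebesgue_on Z. weak_gradient Z (\<lambda>z. v z + t * w z) z
      = weak_gradient Z v z + t *\<^sub>R weak_gradient Z w z"
proof -
  note wg = H1w_weak_gradient[OF v Z \<omega>(1)] H1w_weak_gradient[OF w Z \<omega>(1)]
  have hwg: "has_weak_gradient Z (\<lambda>z. v z + t * w z) (\<lambda>z. weak_gradient Z v z + t *\<^sub>R weak_gradient Z w z)"
    using has_weak_gradient_add_scaleR[OF wg(1) wg(3) lebesgue_open[OF Z]] .
  have "v \<in> L2w \<omega> Z" "w \<in> L2w \<omega> Z" using v w by (auto simp: H1w_def)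
  from L2w_add_scaleR[OF this \<omega>] L2w_add_scaleR[OF wg(2) wg(4) \<omega>] hwg
  show H: "(\<lambda>z. v z + t * w z) \<in> H1w \<omega> Z"
    by (auto simp: H1w_def)
  show "AE z in lebesgue_on Z. weak_gradient Z (\<lambda>z. v z + t * w z) z
      = weak_gradient Z v z + t *\<^sub>R weak_gradient Z w z"
    by (rule has_weak_gradient_unique[OF Z H1w_weak_gradient(1)[OF H Z \<omega>(1)] hwg])
qed

section \<open>Linearity of the boundary conditions\<close>

lemma hausdorff_null_subset: "hausdorff_null k N \<Longrightarrow> M \<subseteq> N \<Longrightarrow> hausdorff_null k M"
  unfolding hausdorff_null_def by (meson order_trans)

text \<open>Two coverings whose sums are below half of \<open>\<epsilon>\<close> are interleaved:
  even indices run through the covering of \<open>M\<close>, odd indices through that of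
  \<open>N\<close>.\<close>

lemma hausdorff_null_Un:
  assumes "hausdorff_null k M" and "hausdorff_null k N"
  shows "hausdorff_null k (M \<union> N)"
  unfolding hausdorff_null_def
proof (intro allI impI)
  fix \<epsilon> :: real assume "\<epsilon> > 0"
  then have e: "\<epsilon> / 2 > 0" by simp
  obtain c r where M: "\<forall>i. 0 \<le> r i" "M \<subseteq> (\<Union>i. cball (c i) (r i))" "summable (\<lambda>i::nat. r i ^ k)" "(\<Sum>i. r i ^ k) < \<epsilon> / 2"
    using assms(1) e unfolding hausdorff_null_def by meson
  obtain d s where N: "\<forall>i. 0 \<le> s i" "N \<subseteq> (\<Union>i. cball (d i) (s i))" "summable (\<lambda>i::nat. s i ^ k)" "(\<Sum>i. s i ^ k) < \<epsilon> / 2"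
    using assms(2) e unfolding hausdorff_null_def by meson
  define f where "f i = (if even i then c (i div 2) else d ((i - 1) div 2))" for i
  define g where "g i = (if even i then r (i div 2) else s ((i - 1) div 2))" for i
  have "(\<lambda>i. if even i then r (i div 2) ^ k else s ((i - 1) div 2) ^ k) sums ((\<Sum>i. s i ^ k) + (\<Sum>i. r i ^ k))"
    by (rule sums_if) (use M(3) N(3) in \<open>auto intro: summable_sums\<close>)
  also have "(\<lambda>i. if even i then r (i div 2) ^ k else s ((i - 1) div 2) ^ k) = (\<lambda>i. g i ^ k)"
    by (auto simp: g_def)
  finally have g: "(\<lambda>i. g i ^ k) sums ((\<Sum>i. s i ^ k) + (\<Sum>i. r i ^ k))" .
  have "M \<union> N \<subseteq> (\<Union>i. cball (f i) (g i))"
  proof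
    fix x assume "x \<in> M \<union> N"
    then consider i where "x \<in> cball (c i) (r i)" | i where "x \<in> cball (d i) (s i)"
      using M(2) N(2) by blast
    then show "x \<in> (\<Union>i. cball (f i) (g i))"
    proof cases
      case (1 i)
      then show ?thesis by (intro UN_I[of "2 * i"]) (simp_all add: f_def g_def)
    next
      case (2 i)
      then show ?thesis by (intro UN_I[of "2 * i + 1"]) (simp_all add: f_def g_def)
    qed
  qed
  moreover have "\<forall>i. 0 \<le> g i" using M(1) N(1) by (simp add: g_def)
  moreover have "summable (\<lambda>i. g i ^ k)" "(\<Sum>i. g i ^ k) < \<epsilon>"
    using g M(4) N(4) by (auto simp: sums_iff)
  ultimately show "\<exists>c r. (\<forall>i::nat. 0 \<le> r i) \<and> M \<union> N \<subseteq> (\<Union>i. cball (c i) (r i)) \<and> summable (\<lambda>i. r i ^ k) \<and> (\<Sum>i. r i ^ k) < \<epsilon>"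
    by blast
qed

text \<open>The triangle inequality bounds the mean for the combination by a combination of two
  means that tend to 0. Measurability is what makes the nonnegative integral additive.\<close>

lemma boundary_value_0_add_mult:
  assumes v: "boundary_value Z v p 0" and w: "boundary_value Z w p 0" and Z: "open Z"
    and meas: "v \<in> borel_measurable (lebesgue_on Z)" "w \<in> borel_measurable (lebesgue_on Z)"
  shows "boundary_value Z (\<lambda>z. v z + t * w z) p 0"
proof -
  define I where "I f r = (\<integral>\<^sup>+z \<in> Z \<inter> ball p r. ennreal \<bar>f z - 0\<bar> \<partial>lebesgue)" for f :: "'a \<Rightarrow> real" and r
  define m where "m r = emeasure lebesgue (Z \<inter> ball p r)" for r
  have le: "I (\<lambda>z. v z + t * w z) r \<le> I v r + ennreal \<bar>t\<bar> * I w r" for r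
  proof -
    have S: "Z \<inter> ball p r \<in> sets lebesgue" using Z by (intro lebesgue_open) auto
    have m': "(\<lambda>z. ennreal \<bar>f z - 0\<bar> * indicator (Z \<inter> ball p r) z) \<in> borel_measurable lebesgue"
      if "f \<in> borel_measurable (lebesgue_on Z)" for f :: "'a \<Rightarrow> real"
    proof -
      have f: "f \<in> borel_measurable (lebesgue_on (Z \<inter> ball p r))"
        using that by (rule measurable_restrict_mono) auto
      then have "(\<lambda>z. ennreal \<bar>f z - 0\<bar>) \<in> borel_measurable (lebesgue_on (Z \<inter> ball p r))"
        by measurable
      then show ?thesis
        by (rule borel_measurable_restrict_space_iff_ennreal[THEN iffD1, rotated]) (use S in simp)
    qed
    have "I (\<lambda>z. v z + t * w z) r \<le> (\<integral>\<^sup>+z. ennreal \<bar>v z - 0\<bar> * indicator (Z \<inter> ball p r) z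
        + ennreal \<bar>t\<bar> * (ennreal \<bar>w z - 0\<bar> * indicator (Z \<inter> ball p r) z) \<partial>lebesgue)"
      unfolding I_def
    proof (rule nn_integral_mono)
      fix z
      have "ennreal \<bar>v z + t * w z - 0\<bar> \<le> ennreal (\<bar>v z\<bar> + \<bar>t\<bar> * \<bar>w z\<bar>)"
        by (rule ennreal_leI) (use abs_triangle_ineq[of "v z" "t * w z"] in \<open>simp add: abs_mult\<close>)
      also have "\<dots> = ennreal \<bar>v z\<bar> + ennreal \<bar>t\<bar> * ennreal \<bar>w z\<bar>"
        by (simp add: ennreal_plus ennreal_mult)
      finally show "ennreal \<bar>v z + t * w z - 0\<bar> * indicator (Z \<inter> ball p r) z \<le>
          ennreal \<bar>v z - 0\<bar> * indicator (Z \<inter> ball p r) z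
          + ennreal \<bar>t\<bar> * (ennreal \<bar>w z - 0\<bar> * indicator (Z \<inter> ball p r) z)"
        by (auto simp: indicator_def)
    qed
    also have "\<dots> = I v r + ennreal \<bar>t\<bar> * I w r"
      unfolding I_def using m'[OF meas(1)] m'[OF meas(2)]
      by (subst nn_integral_add) (auto simp: nn_integral_cmult intro!: borel_measurable_times)
    finally show ?thesis .
  qed
  have lim: "((\<lambda>r. I v r / m r + ennreal \<bar>t\<bar> * (I w r / m r)) \<longlongrightarrow> 0 + ennreal \<bar>t\<bar> * 0) (at_right 0)"
    using v w unfolding boundary_value_def I_def[symmetric] m_def[symmetric]
    by (intro tendsto_add ennreal_tendsto_cmult) auto
  have "((\<lambda>r. I (\<lambda>z. v z + t * w z) r / m r) \<longlongrightarrow> 0) (at_right 0)"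
  proof (rule tendsto_sandwich[OF _ _ tendsto_const])
    show "\<forall>\<^sub>F r in at_right 0. I (\<lambda>z. v z + t * w z) r / m r \<le> I v r / m r + ennreal \<bar>t\<bar> * (I w r / m r)"
      using divide_right_mono_ennreal[OF le]
      by (auto simp: add_divide_distrib_ennreal ennreal_times_divide)
    show "((\<lambda>r. I v r / m r + ennreal \<bar>t\<bar> * (I w r / m r)) \<longlongrightarrow> 0) (at_right 0)"
      using lim by simp
  qed simp
  then show ?thesis
    unfolding boundary_value_def I_def m_def .
qed

text \<open>A boundary point that is exceptional for the combination is exceptional for one of the
  two functions.\<close>

lemma vanishes_on_boundary_add_mult:
  assumes v: "vanishes_on_boundary Z S v" and w: "vanishes_on_boundary Z S w" and "open Z"
    and "v \<in> borel_measurable (lebesgue_on Z)" "w \<in> borel_measurable (lebesgue_on Z)"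
  shows "vanishes_on_boundary Z S (\<lambda>z. v z + t * w z)"
  using hausdorff_null_Un[OF v[unfolded vanishes_on_boundary_def] w[unfolded vanishes_on_boundary_def]]
  unfolding vanishes_on_boundary_def
  by (rule hausdorff_null_subset) (use boundary_value_0_add_mult assms(3-5) in blast)

lemma vertical_rep_add_mult:
  assumes "vertical_rep \<Omega> v v'" and "vertical_rep \<Omega> w w'"
  shows "vertical_rep \<Omega> (\<lambda>z. v z + t * w z) (\<lambda>z. v' z + t * w' z)"
proof -
  have "AE z in lebesgue_on (half_cylinder \<Omega>). v' z = v z" "AE z in lebesgue_on (half_cylinder \<Omega>). w' z = w z"
    using assms by (simp_all add: vertical_rep_def)
  then have "AE z in lebesgue_on (half_cylinder \<Omega>). v' z + t * w' z = v z + t * w z"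
    by eventually_elim simp
  moreover have "AE x in lebesgue_on \<Omega>. continuous_on {0..} (\<lambda>y. v' (x, y))"
    "AE x in lebesgue_on \<Omega>. continuous_on {0..} (\<lambda>y. w' (x, y))"
    using assms by (simp_all add: vertical_rep_def)
  then have "AE x in lebesgue_on \<Omega>. continuous_on {0..} (\<lambda>y. v' (x, y) + t * w' (x, y))"
    by eventually_elim (intro continuous_intros)
  ultimately show ?thesis by (simp add: vertical_rep_def)
qed

lemma vanishes_at_infinity_add_mult:
  assumes "vanishes_at_infinity \<Omega> v" and "vanishes_at_infinity \<Omega> w"
  shows "vanishes_at_infinity \<Omega> (\<lambda>z. v z + t * w z)"
proof -
  obtain v' w' where v': "vertical_rep \<Omega> v v'" "AE x in lebesgue_on \<Omega>. ((\<lambda>y. v' (x, y)) \<longlongrightarrow> 0) at_top"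
    and w': "vertical_rep \<Omega> w w'" "AE x in lebesgue_on \<Omega>. ((\<lambda>y. w' (x, y)) \<longlongrightarrow> 0) at_top"
    using assms by (auto simp: vanishes_at_infinity_def)
  have "AE x in lebesgue_on \<Omega>. ((\<lambda>y. v' (x, y) + t * w' (x, y)) \<longlongrightarrow> 0) at_top"
    using v'(2) w'(2)
  proof eventually_elim
    case (elim x)
    then show ?case
      using tendsto_add[OF elim(1) tendsto_mult[OF tendsto_const elim(2)], of t] by simp
  qed
  with vertical_rep_add_mult[OF v'(1) w'(1)] show ?thesis
    unfolding vanishes_at_infinity_def by blast
qed

section \<open>The energy space and its quadratic form\<close>

lemma open_half_cylinder: "open \<Omega> \<Longrightarrow> open (half_cylinder \<Omega>)"
  by (simp add: half_cylinder_def open_Times)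

lemma ypow_borel_measurable [measurable]: "ypow \<alpha> \<in> borel_measurable borel"
proof -
  have eq: "ypow \<alpha> = (\<lambda>z. snd z powr \<alpha>)" by (auto simp: ypow_def)
  show ?thesis unfolding eq
    by (rule powr_real_measurable[OF borel_measurable_continuous_onI[OF continuous_on_snd[OF continuous_on_id]] borel_measurable_const])
qed

lemma ypow_measurable_lebesgue_on: "ypow \<alpha> \<in> borel_measurable (lebesgue_on Z)"
  by (intro measurable_restrict_space1 measurable_completion) simp

lemma ypow_nonneg: "0 \<le> ypow \<alpha> z"
  by (simp add: ypow_def split: prod.split)

lemma H1b_add_mult:
  assumes v: "v \<in> H1b \<alpha> \<Omega>" and w: "w \<in> H1b \<alpha> \<Omega>" and \<Omega>: "open \<Omega>"
  shows "(\<lambda>z. v z + t * w z) \<in> H1b \<alpha> \<Omega>"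
proof -
  have H: "v \<in> H1w (ypow \<alpha>) (half_cylinder \<Omega>)" "w \<in> H1w (ypow \<alpha>) (half_cylinder \<Omega>)"
    using v w by (auto simp: H1b_def)
  then have "v \<in> borel_measurable (lebesgue_on (half_cylinder \<Omega>))" "w \<in> borel_measurable (lebesgue_on (half_cylinder \<Omega>))"
    by (auto simp: H1w_def L2w_def)
  with v w H open_half_cylinder[OF \<Omega>] show ?thesis
    unfolding H1b_def
    by (auto intro!: H1w_add_mult vanishes_at_infinity_add_mult vanishes_on_boundary_add_mult
        ypow_nonneg ypow_measurable_lebesgue_on)
qed

lemma grad_form_add_mult:
  assumes v: "v \<in> H1b \<alpha> \<Omega>" and w: "w \<in> H1b \<alpha> \<Omega>" and \<Omega>: "open \<Omega>"
  shows "grad_form \<alpha> \<Omega> (\<lambda>z. v z + t * w z) (\<lambda>z. v z + t * w z)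
    = grad_form \<alpha> \<Omega> v v + 2 * t * grad_form \<alpha> \<Omega> v w + t\<^sup>2 * grad_form \<alpha> \<Omega> w w"
proof -
  let ?D = "half_cylinder \<Omega>"
  note D = open_half_cylinder[OF \<Omega>] and \<omega> = ypow_measurable_lebesgue_on[of \<alpha> ?D]
  have H: "v \<in> H1w (ypow \<alpha>) ?D" "w \<in> H1w (ypow \<alpha>) ?D"
    using v w by (auto simp: H1b_def)
  note L = H1w_weak_gradient(2)[OF H(1) D \<omega>] H1w_weak_gradient(2)[OF H(2) D \<omega>]
  have G: "weak_gradient ?D (\<lambda>z. v z + t * w z) \<in> L2w (ypow \<alpha>) ?D"
    using H1w_weak_gradient(2)[OF H1w_add_mult(1)[OF H D \<omega> ypow_nonneg] D \<omega>] .
  note G' = L2w_add_scaleR[OF L \<omega> ypow_nonneg, of t]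
  show ?thesis
    unfolding grad_form_def innerw_add_scaleR_self[OF L \<omega> ypow_nonneg, symmetric]
    by (rule innerw_cong_AE[OF G G' G G' \<omega>]) (intro H1w_add_mult(2)[OF H D \<omega> ypow_nonneg])+
qed

lemma grad_form_nonneg: "0 \<le> grad_form \<alpha> \<Omega> v v"
  unfolding grad_form_def innerw_def by (intro integral_nonneg_AE) (simp add: ypow_nonneg)

section \<open>Traces\<close>

definition smooth_step_deriv :: "real \<Rightarrow> real" where
  "smooth_step_deriv x = frechet_derivative smooth_step (at x) 1"

lemma C_k_smooth_step_deriv: "C_k k smooth_step_deriv"
  using C_k_smooth_step[of "Suc k"] by (simp add: smooth_step_deriv_def[abs_def])

lemma has_real_derivative_smooth_step: "(smooth_step has_real_derivative smooth_step_deriv x) (at x)"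
proof -
  have D: "(smooth_step has_derivative frechet_derivative smooth_step (at x)) (at x)"
    by (rule C_k_Suc_has_derivative[OF C_k_smooth_step])
  then have "frechet_derivative smooth_step (at x) h = smooth_step_deriv x * h" for h
    using linear_scale[OF has_derivative_linear[OF D], of h 1]
    by (simp add: smooth_step_deriv_def)
  then have "frechet_derivative smooth_step (at x) = (*) (smooth_step_deriv x)" by auto
  with D show ?thesis by (simp add: has_field_derivative_def)
qed

lemma smooth_step_deriv_eq_0: "x \<notin> {0..1} \<Longrightarrow> smooth_step_deriv x = 0"
proof -
  assume x: "x \<notin> {0..1}"
  define c where "c = smooth_step x"
  have "((\<lambda>_. c) has_real_derivative 0) (at x)" by simp
  moreover have "\<forall>\<^sub>F y in nhds x. c = smooth_step y"
  proof -
    consider "x < 0" | "x > 1" using x by force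
    then show ?thesis
    proof cases
      case 1
      then show ?thesis
        using eventually_nhds_in_open[of "{..<0}" x]
        by (auto elim!: eventually_mono simp: c_def smooth_step_eq_0)
    next
      case 2
      then show ?thesis
        using eventually_nhds_in_open[of "{1<..}" x]
        by (auto elim!: eventually_mono simp: c_def smooth_step_eq_1)
    qed
  qed
  ultimately have "(smooth_step has_real_derivative 0) (at x)"
    using DERIV_cong_ev[OF refl _ refl, where x = x and f = "\<lambda>_. c" and g = smooth_step and u = 0] by simp
  then show ?thesis
    using has_real_derivative_smooth_step DERIV_unique by blast
qed

lemma smooth_step_deriv_bounded:
  obtains M where "M > 0" "\<And>x. \<bar>smooth_step_deriv x\<bar> \<le> M"
proof -
  have "continuous_on {0..1} smooth_step_deriv"
    using C_k_imp_continuous[OF C_k_smooth_step_deriv] continuous_on_subset by blast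
  then have "bounded (smooth_step_deriv ` {0..1})"
    by (intro compact_imp_bounded compact_continuous_image) auto
  then obtain M where "\<forall>z \<in> smooth_step_deriv ` {0..1}. norm z \<le> M"
    unfolding bounded_iff by blast
  then have M: "\<bar>smooth_step_deriv x\<bar> \<le> M" if "x \<in> {0..1}" for x
    using imageI[OF that, of smooth_step_deriv] by (metis real_norm_def)
  show ?thesis
  \<comment> \<open>The maximum with 1 makes the bound positive; it serves as a divisor
    later.\<close>
  proof (rule that[of "max M 1"])
    show "\<bar>smooth_step_deriv x\<bar> \<le> max M 1" for x
      using M[of x] smooth_step_deriv_eq_0[of x] by (cases "x \<in> {0..1}") auto
  qed simp
qed

text \<open>The derivative of y \<mapsto> \<open>smooth_step (real n * y - 1)\<close>: an
  approximate identity living on [1/n, 2/n]. The shift by 1 keeps it away from y = 0.\<close>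

definition trace_kernel :: "nat \<Rightarrow> real \<Rightarrow> real" where
  "trace_kernel n y = real n * smooth_step_deriv (real n * y - 1)"

text \<open>The function \<open>\<psi>\<close> of the overview. Its falling part is the
  antiderivative of \<open>trace_kernel 1\<close>, so its derivative is a difference of two kernels,
  of which only the first moves with n.\<close>

definition trace_cutoff :: "nat \<Rightarrow> real \<Rightarrow> real" where
  "trace_cutoff n y = smooth_step (real n * y - 1) - smooth_step (y - 1)"

lemma C_k_smooth_step_affine: "C_k k (\<lambda>y. smooth_step (c * y + d))"
  by (intro C_k_compose_affine C_k_smooth_step bounded_linear_mult_right)

lemma C_k_trace_cutoff: "C_k k (trace_cutoff n)"
  using C_k_diff[OF C_k_smooth_step_affine[of k "real n" "- 1"] C_k_smooth_step_affine[of k 1 "- 1"]]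
  by (simp add: trace_cutoff_def[abs_def])

lemma continuous_on_trace_kernel: "continuous_on A (trace_kernel n)"
proof -
  have "continuous_on UNIV smooth_step_deriv"
    using C_k_imp_continuous[OF C_k_smooth_step_deriv] .
  then have "continuous_on A (\<lambda>y. smooth_step_deriv (real n * y - 1))"
    by (rule continuous_on_compose2) (auto intro!: continuous_intros)
  then show ?thesis
    unfolding trace_kernel_def[abs_def] by (intro continuous_intros)
qed

lemma trace_kernel_measurable [measurable]: "trace_kernel n \<in> borel_measurable borel"
  by (intro borel_measurable_continuous_onI continuous_on_trace_kernel)

lemma trace_cutoff_measurable [measurable]: "trace_cutoff n \<in> borel_measurable borel"
  by (intro borel_measurable_continuous_onI C_k_imp_continuous[OF C_k_trace_cutoff])

lemma has_real_derivative_smooth_step_scaled: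
  "((\<lambda>y. smooth_step (real n * y - 1)) has_real_derivative trace_kernel n y) (at y)"
proof -
  have "((\<lambda>y. real n * y - 1) has_real_derivative real n) (at y)"
    by (auto intro!: derivative_eq_intros)
  from DERIV_chain2[OF has_real_derivative_smooth_step this] show ?thesis
    by (simp add: trace_kernel_def mult.commute)
qed

lemma has_real_derivative_trace_cutoff:
  "(trace_cutoff n has_real_derivative (trace_kernel n y - trace_kernel 1 y)) (at y)"
  using DERIV_diff[OF has_real_derivative_smooth_step_scaled has_real_derivative_smooth_step_scaled[of 1]]
  by (simp add: trace_cutoff_def[abs_def])

lemma trace_kernel_eq_0: "n \<ge> 1 \<Longrightarrow> y \<notin> {1 / real n..2 / real n} \<Longrightarrow> trace_kernel n y = 0"
  unfolding trace_kernel_def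
  by (subst smooth_step_deriv_eq_0) (auto simp: field_simps)

lemma trace_cutoff_eq_0: "n \<ge> 2 \<Longrightarrow> y \<notin> {1 / real n..2} \<Longrightarrow> trace_cutoff n y = 0"
proof -
  assume n: "n \<ge> 2" and y: "y \<notin> {1 / real n..2}"
  show ?thesis
  proof (cases "y > 2")
    case True
    then have "real n * y \<ge> 2 * 2" using n by (intro mult_mono) auto
    with True show ?thesis by (simp add: trace_cutoff_def smooth_step_eq_1)
  next
    case False
    with y have "y < 1 / real n" by auto
    with n have "real n * y \<le> 1" by (simp add: field_simps)
    moreover have "1 / real n \<le> 1" using n by simp
    ultimately show ?thesis
      using \<open>y < 1 / real n\<close> by (simp add: trace_cutoff_def smooth_step_eq_0)
  qed
qed

lemma trace_cutoff_abs_le_1: "\<bar>trace_cutoff n y\<bar> \<le> 1"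
  using smooth_step_bounds[of "real n * y - 1"] smooth_step_bounds[of "y - 1"]
  unfolding trace_cutoff_def by linarith

lemma has_bochner_integral_trace_kernel:
  assumes "n \<ge> 1"
  shows "has_bochner_integral lborel (trace_kernel n) 1"
proof -
  have "has_bochner_integral lborel (\<lambda>y. indicator {1 / real n..2 / real n} y *\<^sub>R trace_kernel n y)
      (smooth_step (real n * (2 / real n) - 1) - smooth_step (real n * (1 / real n) - 1))"
  proof (rule has_bochner_integral_FTC_Icc)
    show "((\<lambda>y. smooth_step (real n * y - 1)) has_vector_derivative trace_kernel n x) (at x within {1 / real n..2 / real n})" for x
      using has_field_derivative_at_within[OF has_real_derivative_smooth_step_scaled]
      by (simp add: has_real_derivative_iff_has_vector_derivative)
  qed (use assms in \<open>auto simp: continuous_on_trace_kernel divide_right_mono\<close>)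
  also have "(\<lambda>y. indicator {1 / real n..2 / real n} y *\<^sub>R trace_kernel n y) = trace_kernel n"
    using trace_kernel_eq_0[OF assms] by (fastforce simp: indicator_def)
  finally show ?thesis
    using assms by (simp add: smooth_step_eq_0 smooth_step_eq_1)
qed

section \<open>Values at y = 0 on a single vertical line\<close>

text \<open>Here \<open>q\<close> is a Borel version of the continuous function \<open>w\<close> on
  the open half-line. The kernel is supported on a compact interval of that half-line, where
  \<open>w\<close> is bounded.\<close>

lemma integrable_mult_trace_kernel:
  assumes w: "continuous_on {0..} w" and q [measurable]: "q \<in> borel_measurable borel"
    and eq: "AE y in lborel. y > 0 \<longrightarrow> w y = q y" and n: "n \<ge> 1"
  shows "integrable lborel (\<lambda>y. q y * trace_kernel n y)"
proof -
  let ?I = "{1 / real n..2 / real n}"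
  have "bounded ((\<lambda>y. w y * trace_kernel n y) ` ?I)"
    by (intro compact_imp_bounded compact_continuous_image continuous_intros continuous_on_trace_kernel
        continuous_on_subset[OF w]) (auto intro: order_trans[rotated])
  then obtain C where "\<forall>z \<in> (\<lambda>y. w y * trace_kernel n y) ` ?I. norm z \<le> C"
    unfolding bounded_iff by blast
  then have C: "\<bar>w y * trace_kernel n y\<bar> \<le> C" if "y \<in> ?I" for y
    using imageI[OF that, of "\<lambda>y. w y * trace_kernel n y"] by (metis real_norm_def)
  show ?thesis
  proof (rule Bochner_Integration.integrable_bound)
    show "integrable lborel (\<lambda>y. C * indicator ?I y :: real)"
      by (intro integrable_mult_right integrable_real_indicator) (auto simp: emeasure_lborel_Icc_eq)
    show "AE y in lborel. norm (q y * trace_kernel n y) \<le> norm (C * indicator ?I y :: real)"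
      using eq
    proof eventually_elim
      case (elim y)
      show ?case
      proof (cases "y \<in> ?I")
        case True
        moreover from this n have "y > 0" by (auto intro: less_le_trans[rotated])
        ultimately show ?thesis using elim C[of y] by auto
      qed (use n in \<open>simp add: trace_kernel_eq_0\<close>)
    qed
  qed measurable
qed

text \<open>As the kernel has integral 1, the error is the integral of
  \<open>(q y - w 0) * trace_kernel n y\<close>. The first factor is small near 0 by continuity, and
  the absolute value of the kernel has integral at most \<open>M\<close>, whatever n is.\<close>

lemma trace_kernel_tendsto:
  assumes w: "continuous_on {0..} w" and q [measurable]: "q \<in> borel_measurable borel"
    and eq: "AE y in lborel. y > 0 \<longrightarrow> w y = q y"
  shows "(\<lambda>n. \<integral>y. q y * trace_kernel n y \<partial>lborel) \<longlonglongrightarrow> w 0"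
proof (rule tendstoI)
  fix e :: real assume e: "e > 0"
  obtain M where M: "M > 0" "\<And>x. \<bar>smooth_step_deriv x\<bar> \<le> M"
    by (rule smooth_step_deriv_bounded) (rule that)
  \<comment> \<open>The kernel is at most n * \<open>M\<close> in absolute value on an interval of
    length 1/n, so the error is at most \<open>\<epsilon> * M\<close>, which is e/2.\<close>
  define \<epsilon> where "\<epsilon> = e / (2 * M)"
  have "\<epsilon> > 0" using e M by (simp add: \<epsilon>_def)
  then obtain d where d: "d > 0" "\<And>y. y \<in> {0..} \<Longrightarrow> dist y 0 < d \<Longrightarrow> dist (w y) (w 0) < \<epsilon>"
    using w unfolding continuous_on_iff by (metis atLeast_iff order_refl)
  have "\<forall>\<^sub>F n in sequentially. real n > max 1 (2 / d)"
    using filterlim_at_top_dense filterlim_real_sequentially by blast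
  then show "\<forall>\<^sub>F n in sequentially. dist (\<integral>y. q y * trace_kernel n y \<partial>lborel) (w 0) < e"
  proof eventually_elim
    case (elim n)
    let ?I = "{1 / real n..2 / real n}"
    have n: "n \<ge> 1" "real n > 0" "2 / real n < d"
      using elim d(1) by (auto simp: field_simps)
    note k = has_bochner_integral_trace_kernel[OF n(1)]
    note int = integrable_mult_trace_kernel[OF w q eq n(1)]
    have "(\<integral>y. q y * trace_kernel n y \<partial>lborel) - w 0
      = (\<integral>y. q y * trace_kernel n y \<partial>lborel) - (\<integral>y. w 0 * trace_kernel n y \<partial>lborel)"
      using k by (simp add: has_bochner_integral_iff)
    also have "\<dots> = (\<integral>y. (q y - w 0) * trace_kernel n y \<partial>lborel)"
      using k int by (simp add: has_bochner_integral_iff left_diff_distrib)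
    finally have "\<bar>(\<integral>y. q y * trace_kernel n y \<partial>lborel) - w 0\<bar> \<le> (\<integral>y. \<bar>(q y - w 0) * trace_kernel n y\<bar> \<partial>lborel)"
      using integral_abs_bound[of lborel "\<lambda>y. (q y - w 0) * trace_kernel n y"] by simp
    also have "\<dots> \<le> (\<integral>y. (\<epsilon> * (real n * M)) * indicator ?I y \<partial>lborel)"
    proof (rule integral_mono_AE)
      show "integrable lborel (\<lambda>y. \<bar>(q y - w 0) * trace_kernel n y\<bar>)"
        using k int by (intro integrable_abs) (simp add: has_bochner_integral_iff left_diff_distrib)
      show "integrable lborel (\<lambda>y. (\<epsilon> * (real n * M)) * indicator ?I y :: real)"
        by (intro integrable_mult_right integrable_real_indicator) (auto simp: emeasure_lborel_Icc_eq)
      show "AE y in lborel. \<bar>(q y - w 0) * trace_kernel n y\<bar> \<le> (\<epsilon> * (real n * M)) * indicator ?I y"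
        using eq
      proof eventually_elim
        case (elim y)
        show ?case
        proof (cases "y \<in> ?I")
          case True
          moreover from this n have "y > 0" by (auto intro: less_le_trans[rotated])
          moreover from this True n have "\<bar>w y - w 0\<bar> < \<epsilon>"
            using d(2)[of y] by (auto simp: dist_real_def)
          moreover have "\<bar>trace_kernel n y\<bar> \<le> real n * M"
            unfolding trace_kernel_def abs_mult using M(2) by (intro mult_mono) auto
          ultimately show ?thesis
            using elim by (auto simp: abs_mult intro!: mult_mono)
        qed (use n in \<open>simp add: trace_kernel_eq_0\<close>)
      qed
    qed
    also have "\<dots> = \<epsilon> * M"
      using n by (simp add: measure_lborel_Icc divide_right_mono field_simps)
    also have "\<dots> < e" using e M by (simp add: \<epsilon>_def)
    finally show ?case by (simp add: dist_real_def)
  qed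
qed

text \<open>The hypothesis \<open>parts\<close> trades the mean of \<open>q\<close> near 0 for an
  integral of \<open>q\<close> against the fixed kernel \<open>trace_kernel 1\<close> and of
  \<open>p\<close> against a cutoff bounded by 1. The right-hand side bounds these for every n, so
  the bound survives the limit. When it is infinite there is nothing to show; when it is finite it
  also supplies the integrability needed.\<close>

lemma trace_line_bound:
  assumes M: "\<And>x. \<bar>smooth_step_deriv x\<bar> \<le> M"
    and w: "continuous_on {0..} w" and q [measurable]: "q \<in> borel_measurable borel"
    and p [measurable]: "p \<in> borel_measurable borel"
    and eq: "AE y in lborel. y > 0 \<longrightarrow> w y = q y"
    and parts: "\<And>n. n \<ge> 2 \<Longrightarrow> (\<integral>y. q y * (trace_kernel n y - trace_kernel 1 y) + p y * trace_cutoff n y \<partial>lborel) = 0"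
  shows "ennreal \<bar>w 0\<bar> \<le> (\<integral>\<^sup>+y. ennreal (M * \<bar>q y\<bar> + \<bar>p y\<bar>) * indicator {0..2} y \<partial>lborel)"
    (is "_ \<le> ?B")
proof (cases "?B = \<infinity>")
  case False
  have M0: "M \<ge> 0" using M[of 0] by linarith
  have B: "integrable lborel (\<lambda>y. (M * \<bar>q y\<bar> + \<bar>p y\<bar>) * indicator {0..2} y)"
  proof (rule integrableI_bounded)
    have "(\<integral>\<^sup>+y. ennreal (norm ((M * \<bar>q y\<bar> + \<bar>p y\<bar>) * indicator {0..2} y)) \<partial>lborel) = ?B"
      using M0 by (intro nn_integral_cong) (auto simp: indicator_def)
    then show "(\<integral>\<^sup>+y. ennreal (norm ((M * \<bar>q y\<bar> + \<bar>p y\<bar>) * indicator {0..2} y)) \<partial>lborel) < \<infinity>"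
      using False by (simp add: less_top)
  qed measurable
  have "\<bar>\<integral>y. q y * trace_kernel n y \<partial>lborel\<bar> \<le> (\<integral>y. (M * \<bar>q y\<bar> + \<bar>p y\<bar>) * indicator {0..2} y \<partial>lborel)"
    if n: "n \<ge> 2" for n
  proof -
    have kn: "integrable lborel (\<lambda>y. q y * trace_kernel n y)" "integrable lborel (\<lambda>y. q y * trace_kernel 1 y)"
      using integrable_mult_trace_kernel[OF w q eq] n by auto
    have bnd: "\<bar>q y * trace_kernel 1 y - p y * trace_cutoff n y\<bar> \<le> (M * \<bar>q y\<bar> + \<bar>p y\<bar>) * indicator {0..2} y" for y
    proof (cases "y \<in> {0..2}")
      case True
      have "\<bar>q y * trace_kernel 1 y - p y * trace_cutoff n y\<bar> \<le> \<bar>q y * trace_kernel 1 y\<bar> + \<bar>p y * trace_cutoff n y\<bar>"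
        by (rule abs_triangle_ineq4)
      also have "\<dots> \<le> \<bar>q y\<bar> * M + \<bar>p y\<bar> * 1"
        unfolding abs_mult using M[of "y - 1"] trace_cutoff_abs_le_1[of n y]
        by (intro add_mono mult_left_mono) (auto simp: trace_kernel_def)
      finally show ?thesis using True by (simp add: mult.commute)
    next
      case False
      moreover from this have "y \<notin> {1 / real n..2}" by (auto intro: order_trans[rotated])
      ultimately show ?thesis
        using trace_kernel_eq_0[of 1 y] trace_cutoff_eq_0[OF n, of y] by auto
    qed
    \<comment> \<open>The hypothesis \<open>parts\<close> concerns one integral; it may be split
      only because both pieces are integrable.\<close>
    have pn: "integrable lborel (\<lambda>y. q y * trace_kernel 1 y - p y * trace_cutoff n y)"
      by (rule Bochner_Integration.integrable_bound[OF B]) (use bnd in \<open>auto intro: order_trans[OF _ abs_ge_self]\<close>)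
    have "(\<integral>y. q y * trace_kernel n y \<partial>lborel) - (\<integral>y. q y * trace_kernel 1 y - p y * trace_cutoff n y \<partial>lborel)
      = (\<integral>y. q y * (trace_kernel n y - trace_kernel 1 y) + p y * trace_cutoff n y \<partial>lborel)"
      unfolding Bochner_Integration.integral_diff[OF kn(1) pn, symmetric] by (simp add: algebra_simps)
    also have "\<dots> = 0" by (rule parts[OF n])
    finally have "(\<integral>y. q y * trace_kernel n y \<partial>lborel) = (\<integral>y. q y * trace_kernel 1 y - p y * trace_cutoff n y \<partial>lborel)"
      by simp
    also have "\<bar>\<dots>\<bar> \<le> (\<integral>y. \<bar>q y * trace_kernel 1 y - p y * trace_cutoff n y\<bar> \<partial>lborel)"
      by (rule integral_abs_bound)
    also have "\<dots> \<le> (\<integral>y. (M * \<bar>q y\<bar> + \<bar>p y\<bar>) * indicator {0..2} y \<partial>lborel)"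
      by (intro integral_mono integrable_abs pn B bnd)
    finally show ?thesis .
  qed
  moreover have "(\<lambda>n. \<bar>\<integral>y. q y * trace_kernel n y \<partial>lborel\<bar>) \<longlonglongrightarrow> \<bar>w 0\<bar>"
    by (intro tendsto_rabs trace_kernel_tendsto[OF w q eq])
  ultimately have "\<bar>w 0\<bar> \<le> (\<integral>y. (M * \<bar>q y\<bar> + \<bar>p y\<bar>) * indicator {0..2} y \<partial>lborel)"
    using tendsto_upperbound eventually_ge_at_top[of 2]
    by (metis (no_types, lifting) eventually_mono sequentially_bot)
  also have "ennreal \<dots> = (\<integral>\<^sup>+y. ennreal ((M * \<bar>q y\<bar> + \<bar>p y\<bar>) * indicator {0..2} y) \<partial>lborel)"
    using M0 by (intro nn_integral_eq_integral[symmetric] B) auto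
  also have "\<dots> = ?B"
    by (intro nn_integral_cong) (auto simp: indicator_def)
  finally show ?thesis by (simp add: ennreal_leI)
qed simp

section \<open>Borel representatives, uniqueness and measurability of traces\<close>

text \<open>Extension by 0 followed by a change on a null set gives a Borel function on the whole
  space; its sections are again Borel, as Fubini requires.\<close>

lemma borel_measurable_representative:
  fixes v :: "'z::euclidean_space \<Rightarrow> real"
  assumes "Z \<in> sets lebesgue" and "v \<in> borel_measurable (lebesgue_on Z)"
  obtains v' where "v' \<in> borel_measurable borel" "AE z in lborel. (if z \<in> Z then v z else 0) = v' z"
proof -
  have "\<exists>v'\<in>borel_measurable lborel. AE z in lborel. (if z \<in> Z then v z else 0) = v' z"
    by (rule completion_ex_borel_measurable_real[OF borel_measurable_if_I[OF assms(2,1)]])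
  then show ?thesis using that by auto
qed

lemma AE_lebesgue_on_iff: "Z \<in> sets lebesgue \<Longrightarrow> (AE z in lebesgue_on Z. P z) \<longleftrightarrow> (AE z in lborel. z \<in> Z \<longrightarrow> P z)"
  by (simp add: AE_restrict_space_iff AE_completion_iff)

text \<open>By Fubini, almost every vertical line meets the exceptional null set of the product in a
  null set of the line.\<close>

lemma vertical_rep_AE_lines:
  assumes \<Omega>: "open \<Omega>" and w: "vertical_rep \<Omega> v w"
    and v': "AE z in lborel. (if z \<in> half_cylinder \<Omega> then v z else 0) = v' z"
  shows "AE x in lborel. x \<in> \<Omega> \<longrightarrow> continuous_on {0..} (\<lambda>y. w (x, y)) \<and>
    (AE y in lborel. y > 0 \<longrightarrow> w (x, y) = v' (x, y))"
proof -
  have "AE z in lborel. z \<in> half_cylinder \<Omega> \<longrightarrow> w z = v z"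
    using w lebesgue_open[OF open_half_cylinder[OF \<Omega>]]
    by (simp add: vertical_rep_def AE_lebesgue_on_iff)
  with v' have "AE z in lborel. z \<in> half_cylinder \<Omega> \<longrightarrow> w z = v' z"
    by eventually_elim (simp split: if_splits)
  then have "AE z in lborel \<Otimes>\<^sub>M lborel. z \<in> half_cylinder \<Omega> \<longrightarrow> w z = v' z"
    unfolding lborel_prod .
  from lborel_pair.AE_pair[OF this]
  have "AE x in lborel. AE y in lborel. (x, y) \<in> half_cylinder \<Omega> \<longrightarrow> w (x, y) = v' (x, y)" .
  moreover have "AE x in lborel. x \<in> \<Omega> \<longrightarrow> continuous_on {0..} (\<lambda>y. w (x, y))"
    using w lebesgue_open[OF \<Omega>] by (simp add: vertical_rep_def AE_lebesgue_on_iff)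
  ultimately show ?thesis
    by eventually_elim (auto simp: half_cylinder_def)
qed

lemma borel_measurable_section:
  fixes v' :: "'a::euclidean_space \<times> real \<Rightarrow> real"
  assumes "v' \<in> borel_measurable borel"
  shows "(\<lambda>y. v' (x, y)) \<in> borel_measurable borel"
  by (rule measurable_compose[OF _ assms]) (auto intro!: borel_measurable_continuous_onI continuous_intros)

text \<open>The sequence on the left involves only \<open>v'\<close>, so it determines the value at
  y = 0 of every vertical representative of \<open>v\<close>, up to a null set of x.\<close>

lemma vertical_rep_trace_kernel_tendsto:
  assumes \<Omega>: "open \<Omega>" and w: "vertical_rep \<Omega> v w"
    and v': "v' \<in> borel_measurable borel" "AE z in lborel. (if z \<in> half_cylinder \<Omega> then v z else 0) = v' z"
  shows "AE x in lebesgue_on \<Omega>. (\<lambda>n. \<integral>y. v' (x, y) * trace_kernel n y \<partial>lborel) \<longlonglongrightarrow> w (x, 0)"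
  unfolding AE_lebesgue_on_iff[OF lebesgue_open[OF \<Omega>]]
  using vertical_rep_AE_lines[OF \<Omega> w v'(2)]
proof eventually_elim
  case (elim x)
  then show ?case
    using trace_kernel_tendsto[OF _ borel_measurable_section[OF v'(1)], of "\<lambda>y. w (x, y)" x] by auto
qed

lemma H1b_vertical_rep:
  assumes "v \<in> H1b \<alpha> \<Omega>"
  obtains w where "vertical_rep \<Omega> v w" "tr \<Omega> v = (\<lambda>x. w (x, 0))"
proof (rule that)
  have "\<exists>w. vertical_rep \<Omega> v w"
    using assms by (auto simp: H1b_def vanishes_at_infinity_def)
  then show "vertical_rep \<Omega> v (SOME w. vertical_rep \<Omega> v w)" by (rule someI_ex)
qed (simp add: tr_def)

lemma H1b_measurable: "v \<in> H1b \<alpha> \<Omega> \<Longrightarrow> v \<in> borel_measurable (lebesgue_on (half_cylinder \<Omega>))"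
  by (simp add: H1b_def H1w_def L2w_def)

text \<open>The representative chosen for the combination and the combination of the chosen
  representatives represent the same function; their values at y = 0 are limits of one
  sequence.\<close>

lemma tr_add_mult:
  assumes v: "v \<in> H1b \<alpha> \<Omega>" and w: "w \<in> H1b \<alpha> \<Omega>" and \<Omega>: "open \<Omega>"
  shows "AE x in lebesgue_on \<Omega>. tr \<Omega> (\<lambda>z. v z + t * w z) x = tr \<Omega> v x + t * tr \<Omega> w x"
proof -
  note vw = H1b_add_mult[OF v w \<Omega>, of t]
  obtain rv where rv: "vertical_rep \<Omega> v rv" "tr \<Omega> v = (\<lambda>x. rv (x, 0))" by (rule H1b_vertical_rep[OF v])
  obtain rw where rw: "vertical_rep \<Omega> w rw" "tr \<Omega> w = (\<lambda>x. rw (x, 0))" by (rule H1b_vertical_rep[OF w])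
  obtain r where r: "vertical_rep \<Omega> (\<lambda>z. v z + t * w z) r" "tr \<Omega> (\<lambda>z. v z + t * w z) = (\<lambda>x. r (x, 0))"
    by (rule H1b_vertical_rep[OF vw])
  obtain v' where v': "v' \<in> borel_measurable borel"
    "AE z in lborel. (if z \<in> half_cylinder \<Omega> then v z + t * w z else 0) = v' z"
    using borel_measurable_representative[OF lebesgue_open[OF open_half_cylinder[OF \<Omega>]] H1b_measurable[OF vw]] by blast
  show ?thesis
    using vertical_rep_trace_kernel_tendsto[OF \<Omega> r(1) v']
      vertical_rep_trace_kernel_tendsto[OF \<Omega> vertical_rep_add_mult[OF rv(1) rw(1), of t] v']
  proof eventually_elim
    case (elim x)
    from LIMSEQ_unique[OF elim] show ?case using r(2) rv(2) rw(2) by simp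
  qed
qed

lemma tr_measurable:
  assumes v: "v \<in> H1b \<alpha> \<Omega>" and \<Omega>: "open \<Omega>"
  shows "tr \<Omega> v \<in> borel_measurable (lebesgue_on \<Omega>)"
proof -
  obtain w where w: "vertical_rep \<Omega> v w" "tr \<Omega> v = (\<lambda>x. w (x, 0))" by (rule H1b_vertical_rep[OF v])
  obtain v' where v': "v' \<in> borel_measurable borel"
    "AE z in lborel. (if z \<in> half_cylinder \<Omega> then v z else 0) = v' z"
    using borel_measurable_representative[OF lebesgue_open[OF open_half_cylinder[OF \<Omega>]] H1b_measurable[OF v]] by blast
  have [measurable]: "v' \<in> borel_measurable (borel \<Otimes>\<^sub>M borel)"
    using v'(1) by (simp add: borel_prod)
  \<comment> \<open>Where the sequence diverges, \<open>lim\<close> is a default value; within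
    \<open>\<Omega>\<close> this concerns a null set only.\<close>
  have "(\<lambda>x. lim (\<lambda>n. \<integral>y. v' (x, y) * trace_kernel n y \<partial>lborel)) \<in> borel_measurable borel"
    by measurable
  then have m: "(\<lambda>x. lim (\<lambda>n. \<integral>y. v' (x, y) * trace_kernel n y \<partial>lborel)) \<in> borel_measurable (lebesgue_on \<Omega>)"
    by (intro measurable_restrict_space1 measurable_completion) simp
  have "AE x in lebesgue_on \<Omega>. lim (\<lambda>n. \<integral>y. v' (x, y) * trace_kernel n y \<partial>lborel) = tr \<Omega> v x"
    using vertical_rep_trace_kernel_tendsto[OF \<Omega> w(1) v']
    by eventually_elim (simp add: w(2) limI)
  then show ?thesis
    by (rule borel_measurable_lebesgue_on_AE[OF lebesgue_open[OF \<Omega>] m])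
qed

section \<open>Integration by parts on almost every vertical line\<close>

lemma product_test_function:
  fixes \<phi> :: "'a::euclidean_space \<Rightarrow> real"
  assumes \<phi>: "\<phi> \<in> test_functions \<Omega>" and \<psi>: "\<And>k. C_k k \<psi>" "\<And>y. y \<notin> {a..b} \<Longrightarrow> \<psi> y = 0" and "0 < a"
    and \<psi>': "\<And>y. (\<psi> has_real_derivative \<psi>' y) (at y)"
  shows "(\<lambda>z. \<phi> (fst z) * \<psi> (snd z)) \<in> test_functions (half_cylinder \<Omega>)"
    and "frechet_derivative (\<lambda>z. \<phi> (fst z) * \<psi> (snd z)) (at z) (0, 1) = \<phi> (fst z) * \<psi>' (snd z)"
proof -
  have C: "C_k k \<phi>" for k using \<phi> by (simp add: test_functions_def)
  obtain K where K: "compact K" "K \<subseteq> \<Omega>" "\<And>x. x \<notin> K \<Longrightarrow> \<phi> x = 0"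
    using test_function_support[OF \<phi>] by metis
  show "(\<lambda>z. \<phi> (fst z) * \<psi> (snd z)) \<in> test_functions (half_cylinder \<Omega>)"
  proof (rule test_functionsI)
    show "C_k k (\<lambda>z. \<phi> (fst z) * \<psi> (snd z))" for k
      using C_k_compose_affine[OF bounded_linear_fst C, of k 0] C_k_compose_affine[OF bounded_linear_snd \<psi>(1), of k 0]
      by (intro C_k_mult) simp_all
    show "compact (K \<times> {a..b})" using K(1) by (intro compact_Times compact_Icc)
    show "K \<times> {a..b} \<subseteq> half_cylinder \<Omega>" using K(2) \<open>0 < a\<close> by (auto simp: half_cylinder_def)
    show "\<phi> (fst z) * \<psi> (snd z) = 0" if "z \<notin> K \<times> {a..b}" for z
      using that K(3)[of "fst z"] \<psi>(2)[of "snd z"] by (cases z) auto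
  qed
  have D: "(\<phi> has_derivative frechet_derivative \<phi> (at (fst z))) (at (fst z))"
    by (rule C_k_Suc_has_derivative[OF C])
  have "((\<lambda>z. \<phi> (fst z) * \<psi> (snd z)) has_derivative
      (\<lambda>h. \<phi> (fst z) * (\<psi>' (snd z) * snd h) + frechet_derivative \<phi> (at (fst z)) (fst h) * \<psi> (snd z))) (at z)"
    using has_derivative_compose[OF bounded_linear_imp_has_derivative[OF bounded_linear_fst] D]
      has_derivative_compose[OF bounded_linear_imp_has_derivative[OF bounded_linear_snd] \<psi>'[unfolded has_field_derivative_def]]
    by (intro has_derivative_mult)
  from frechet_derivative_at[OF this, symmetric]
  show "frechet_derivative (\<lambda>z. \<phi> (fst z) * \<psi> (snd z)) (at z) (0, 1) = \<phi> (fst z) * \<psi>' (snd z)"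
    using linear_0[OF has_derivative_linear[OF D]] by simp
qed

text \<open>Call the vertical integral \<open>A x\<close>. Testing the weak gradient with
  \<open>\<phi>\<close> times the cutoff gives, by Fubini, that the integral of \<open>A\<close>
  times \<open>\<phi>\<close> vanishes for every test function \<open>\<phi>\<close> on
  \<open>\<Omega>\<close>; the fundamental lemma in x then applies to \<open>A\<close>.\<close>

lemma AE_vertical_integration_by_parts:
  fixes \<Omega> :: "'a::euclidean_space set"
  assumes \<Omega>: "open \<Omega>" and G: "has_weak_gradient (half_cylinder \<Omega>) v G"
    and v': "v' \<in> borel_measurable borel" "AE z in lborel. (if z \<in> half_cylinder \<Omega> then v z else 0) = v' z"
    and g': "g' \<in> borel_measurable borel" "AE z in lborel. (if z \<in> half_cylinder \<Omega> then G z \<bullet> (0, 1) else 0) = g' z"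
    and n: "n \<ge> 2"
  shows "AE x in lebesgue_on \<Omega>.
    (\<integral>y. v' (x, y) * (trace_kernel n y - trace_kernel 1 y) + g' (x, y) * trace_cutoff n y \<partial>lborel) = 0"
proof -
  let ?D = "half_cylinder \<Omega>"
  define \<kappa> where "\<kappa> y = trace_kernel n y - trace_kernel 1 y" for y
  define Q where "Q z = v' z * \<kappa> (snd z) + g' z * trace_cutoff n (snd z)" for z :: "'a \<times> real"
  note D = lebesgue_open[OF open_half_cylinder[OF \<Omega>]]
  have [measurable]: "v' \<in> borel_measurable (borel \<Otimes>\<^sub>M borel)" "g' \<in> borel_measurable (borel \<Otimes>\<^sub>M borel)"
    using v'(1) g'(1) by (simp_all add: borel_prod)
  have [measurable]: "\<kappa> \<in> borel_measurable borel"
    unfolding \<kappa>_def[abs_def] by measurable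
  have Q_meas [measurable]: "Q \<in> borel_measurable (borel \<Otimes>\<^sub>M borel)"
    unfolding Q_def[abs_def] by measurable
  have b: "(0, 1) \<in> (Basis :: ('a \<times> real) set)"
    by (auto simp: Basis_prod_def)
  have pos: "0 < 1 / real n" using n by simp
  have \<kappa>0: "\<kappa> y = 0" and \<psi>0: "trace_cutoff n y = 0" if "y \<notin> {1 / real n..2}" for y
  proof -
    show "trace_cutoff n y = 0" using trace_cutoff_eq_0[OF n that] .
    have "1 / real n \<le> 1" "2 / real n \<le> 2" using n by (auto simp: field_simps)
    then have "y \<notin> {1 / real n..2 / real n}" "y \<notin> {1 / real 1..2 / real 1}"
      using that by auto
    then show "\<kappa> y = 0"
      using trace_kernel_eq_0[of n y] trace_kernel_eq_0[of 1 y] n by (simp add: \<kappa>_def)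
  qed
  have \<kappa>_cont: "continuous_on A \<kappa>" for A
    unfolding \<kappa>_def[abs_def] by (intro continuous_intros continuous_on_trace_kernel)
  define A where "A x = (\<integral>y. Q (x, y) \<partial>lborel)" for x
  have A_meas: "A \<in> borel_measurable borel"
    unfolding A_def[abs_def] by measurable
  \<comment> \<open>Moves an integral from a Lebesgue measurable function to its Borel version,
    where Fubini is available.\<close>
  have transfer: "integrable lborel F \<and> (\<integral>z. F z \<partial>lborel) = (\<integral>z. H z \<partial>lebesgue)"
    if H: "integrable lebesgue H" and F: "F \<in> borel_measurable borel" and eq: "AE z in lborel. H z = F z"
    for F H :: "'a \<times> real \<Rightarrow> real"
  proof -
    have F': "F \<in> borel_measurable lebesgue" using F by (intro measurable_completion) simp
    have eq': "AE z in lebesgue. H z = F z" using eq by (rule AE_completion)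
    have "integrable lebesgue F"
      using integrable_cong_AE_imp[OF H F'] eq' by (simp add: eq_commute)
    moreover have "(\<integral>z. F z \<partial>lebesgue) = (\<integral>z. H z \<partial>lebesgue)"
      by (rule integral_cong_AE) (use F' H eq' in \<open>auto simp: eq_commute\<close>)
    ultimately show ?thesis
      using F by (simp add: integrable_completion integral_completion)
  qed
  have "AE x in lebesgue_on \<Omega>. A x = 0"
  proof (rule fundamental_lemma_calculus_of_variations[OF \<Omega>])
    fix K assume K: "compact K" "K \<subseteq> \<Omega>"
    \<comment> \<open>Local integrability of \<open>A\<close> over \<open>K\<close> comes from
      Fubini on the full cylinder \<open>?Z\<close>. The kernel and the cutoff confine the integrand
      to \<open>?K'\<close>, a compact subset of the half-cylinder.\<close>
    let ?K' = "K \<times> {1 / real n..2}" and ?Z = "K \<times> (UNIV :: real set)"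
    have KD: "?K' \<subseteq> ?D" using K(2) pos by (auto simp: half_cylinder_def intro: less_le_trans[OF pos])
    have K': "compact ?K'" using K(1) by (intro compact_Times compact_Icc)
    have Z: "?Z \<in> sets lebesgue"
      by (intro sets_completionI_sets)
        (simp only: sets_lborel borel_closed closed_Times compact_imp_closed[OF K(1)] closed_UNIV)
    have iv: "integrable (lebesgue_on ?K') v" "integrable (lebesgue_on ?K') (\<lambda>z. G z \<bullet> (0, 1))"
      using G K' KD by (auto simp: has_weak_gradient_def)
    have c: "continuous_on UNIV (\<lambda>z::'a \<times> real. \<kappa> (snd z))" "continuous_on UNIV (\<lambda>z::'a \<times> real. trace_cutoff n (snd z))"
      using continuous_on_compose2[OF \<kappa>_cont continuous_on_snd[OF continuous_on_id], of UNIV UNIV]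
        continuous_on_compose2[OF C_k_imp_continuous[OF C_k_trace_cutoff] continuous_on_snd[OF continuous_on_id], of UNIV n]
      by auto
    have z0: "\<kappa> (snd z) = 0" "trace_cutoff n (snd z) = 0" if "z \<in> ?Z" "z \<notin> ?K'" for z
    proof -
      have "snd z \<notin> {1 / real n..2}" using that by (cases z) auto
      then show "\<kappa> (snd z) = 0" "trace_cutoff n (snd z) = 0" by (rule \<kappa>0, rule \<psi>0)
    qed
    have sub: "?K' \<subseteq> ?Z" by auto
    have "integrable (lebesgue_on ?Z) (\<lambda>z. v z * \<kappa> (snd z))"
      by (rule integrable_mult_compact_support[OF iv(1) K' sub Z c(1) z0(1)])
    moreover have "integrable (lebesgue_on ?Z) (\<lambda>z. (G z \<bullet> (0, 1)) * trace_cutoff n (snd z))"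
      by (rule integrable_mult_compact_support[OF iv(2) K' sub Z c(2) z0(2)])
    ultimately have "integrable (lebesgue_on ?Z) (\<lambda>z. v z * \<kappa> (snd z) + (G z \<bullet> (0, 1)) * trace_cutoff n (snd z))"
      by (rule Bochner_Integration.integrable_add)
    then have H: "integrable lebesgue (\<lambda>z. indicator ?Z z * (v z * \<kappa> (snd z) + (G z \<bullet> (0, 1)) * trace_cutoff n (snd z)))"
      using Z by (simp add: integrable_restrict_space)
    have [measurable]: "K \<in> sets borel" using K(1) by (rule borel_compact)
    have F: "(\<lambda>z. indicator K (fst z) * Q z) \<in> borel_measurable borel"
      unfolding borel_prod[symmetric] by measurable
    have "AE z in lborel. indicator ?Z z * (v z * \<kappa> (snd z) + (G z \<bullet> (0, 1)) * trace_cutoff n (snd z)) = indicator K (fst z) * Q z"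
      using v'(2) g'(2)
    proof eventually_elim
      case (elim z)
      show ?case
      \<comment> \<open>Points of the full cylinder outside the half-cylinder have y \<le> 0, where
        kernel and cutoff vanish.\<close>
      proof (cases "z \<in> ?Z \<and> z \<notin> ?D")
        case True
        then have "snd z \<notin> {1 / real n..2}"
          using K(2) less_le_trans[OF pos, of "snd z"] by (cases z) (auto simp: half_cylinder_def)
        then show ?thesis using \<kappa>0 \<psi>0 by (simp add: Q_def)
      next
        case False
        then show ?thesis
          using elim by (cases z) (auto simp: Q_def indicator_def)
      qed
    qed
    from transfer[OF H F this] have "integrable (lborel \<Otimes>\<^sub>M lborel) (\<lambda>z. indicator K (fst z) * Q z)"
      by (simp add: lborel_prod)
    from lborel_pair.integrable_fst'[OF this] have "integrable lborel (\<lambda>x. indicator K x * A x)"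
      by (simp add: A_def)
    then have "integrable lebesgue (\<lambda>x. indicator K x * A x)"
      using A_meas by (simp add: integrable_completion)
    then show "integrable (lebesgue_on K) A"
      using K(1) by (simp add: integrable_restrict_space sets_completionI_sets borel_compact)
  next
    fix \<phi> assume \<phi>: "\<phi> \<in> test_functions \<Omega>"
    obtain K where K: "K \<subseteq> \<Omega>" "\<And>x. x \<notin> K \<Longrightarrow> \<phi> x = 0"
      using test_function_support[OF \<phi>] by metis
    have [measurable]: "\<phi> \<in> borel_measurable borel"
      by (rule test_function_borel_measurable[OF \<phi>])
    define \<Phi> where "\<Phi> z = \<phi> (fst z) * trace_cutoff n (snd z)" for z
    have \<Phi>: "\<Phi> \<in> test_functions ?D"
      unfolding \<Phi>_def[abs_def]
      by (rule product_test_function(1)[OF \<phi> C_k_trace_cutoff \<psi>0 pos has_real_derivative_trace_cutoff])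
    have d\<Phi>: "frechet_derivative \<Phi> (at z) (0, 1) = \<phi> (fst z) * \<kappa> (snd z)" for z
      unfolding \<Phi>_def[abs_def] \<kappa>_def
      by (rule product_test_function(2)[OF \<phi> C_k_trace_cutoff \<psi>0 pos has_real_derivative_trace_cutoff])
    note int = has_weak_gradient_integrable[OF G \<Phi> b D]
    define J where "J z = v z * (\<phi> (fst z) * \<kappa> (snd z)) + (G z \<bullet> (0, 1)) * \<Phi> z" for z
    have "(\<integral>z. v z * frechet_derivative \<Phi> (at z) (0, 1) \<partial>lebesgue_on ?D) = - (\<integral>z. (G z \<bullet> (0, 1)) * \<Phi> z \<partial>lebesgue_on ?D)"
      using G \<Phi> b by (simp add: has_weak_gradient_def)
    then have J: "integrable (lebesgue_on ?D) J" "(\<integral>z. J z \<partial>lebesgue_on ?D) = 0"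
      using int by (simp_all add: J_def[abs_def] d\<Phi>)
    then have J': "integrable lebesgue (\<lambda>z. indicator ?D z * J z)" "(\<integral>z. indicator ?D z * J z \<partial>lebesgue) = 0"
      using D by (simp_all add: integrable_restrict_space integral_restrict_space)
    have F: "(\<lambda>z. \<phi> (fst z) * Q z) \<in> borel_measurable borel"
      unfolding borel_prod[symmetric] by measurable
    have "AE z in lborel. indicator ?D z * J z = \<phi> (fst z) * Q z"
      using v'(2) g'(2)
      by eventually_elim (auto simp: J_def Q_def \<Phi>_def indicator_def algebra_simps split: if_splits)
    from transfer[OF J'(1) F this] J'(2)
    have FQ: "integrable (lborel \<Otimes>\<^sub>M lborel) (\<lambda>z. \<phi> (fst z) * Q z)" "(\<integral>z. \<phi> (fst z) * Q z \<partial>(lborel \<Otimes>\<^sub>M lborel)) = 0"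
      by (simp_all add: lborel_prod)
    from lborel_pair.integral_fst'[OF FQ(1)] FQ(2)
    have "(\<integral>x. \<phi> x * A x \<partial>lborel) = 0"
      by (simp add: A_def)
    moreover have "(\<integral>x. \<phi> x * A x \<partial>lebesgue) = (\<integral>x. \<phi> x * A x \<partial>lborel)"
      using A_meas by (intro integral_completion) simp
    moreover have "(\<lambda>x. indicator \<Omega> x *\<^sub>R (A x * \<phi> x)) = (\<lambda>x. \<phi> x * A x)"
      using K by (auto simp: indicator_def fun_eq_iff)
    ultimately show "(\<integral>x. A x * \<phi> x \<partial>lebesgue_on \<Omega>) = 0"
      using lebesgue_open[OF \<Omega>] by (subst integral_restrict_space) (simp_all del: real_scaleR_def)
  qed
  then show ?thesis
    by (simp add: A_def Q_def \<kappa>_def)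
qed

section \<open>Square integrability of traces\<close>

lemma L2w_representative_integrable:
  fixes v :: "'a::euclidean_space \<times> real \<Rightarrow> real"
  assumes v: "v \<in> L2w (ypow \<alpha>) Z" and Z: "Z \<in> sets lebesgue"
    and v': "v' \<in> borel_measurable borel" "AE z in lborel. (if z \<in> Z then v z else 0) = v' z"
  shows "integrable lborel (\<lambda>z. (v' z)\<^sup>2 * ypow \<alpha> z)"
proof -
  have int: "integrable lebesgue (\<lambda>z. indicator Z z * ((v z)\<^sup>2 * ypow \<alpha> z))"
    using v Z by (simp add: L2w_def integrable_restrict_space)
  have m: "(\<lambda>z. (v' z)\<^sup>2 * ypow \<alpha> z) \<in> borel_measurable borel"
    using v'(1) by measurable
  have "integrable lebesgue (\<lambda>z. (v' z)\<^sup>2 * ypow \<alpha> z)"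
  proof (rule integrable_cong_AE_imp[OF int])
    show "(\<lambda>z. (v' z)\<^sup>2 * ypow \<alpha> z) \<in> borel_measurable lebesgue"
      using m by (intro measurable_completion) simp
    show "AE z in lebesgue. indicator Z z * ((v z)\<^sup>2 * ypow \<alpha> z) = (v' z)\<^sup>2 * ypow \<alpha> z"
      using AE_completion[OF v'(2)] by eventually_elim (auto simp: indicator_def split: if_splits)
  qed
  then show ?thesis using m by (simp add: integrable_completion)
qed

lemma L2w_component:
  assumes "G \<in> L2w \<omega> Z" and "b \<in> Basis"
    and \<omega>: "\<omega> \<in> borel_measurable (lebesgue_on Z)" "\<And>z. 0 \<le> \<omega> z"
  shows "(\<lambda>z. G z \<bullet> b) \<in> L2w \<omega> Z"
proof -
  have [measurable]: "G \<in> borel_measurable (lebesgue_on Z)" using assms(1) by (simp add: L2w_def)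
  note [measurable] = \<omega>(1)
  have "integrable (lebesgue_on Z) (\<lambda>z. (norm (G z))\<^sup>2 * \<omega> z)"
    using assms(1) by (simp add: L2w_def)
  then have "integrable (lebesgue_on Z) (\<lambda>z. (norm (G z \<bullet> b))\<^sup>2 * \<omega> z)"
  proof (rule Bochner_Integration.integrable_bound)
    have "(norm (G z \<bullet> b))\<^sup>2 \<le> (norm (G z))\<^sup>2" for z
      using Basis_le_norm[OF assms(2), of "G z"] by (intro power_mono) auto
    then show "AE z in lebesgue_on Z. norm ((norm (G z \<bullet> b))\<^sup>2 * \<omega> z) \<le> norm ((norm (G z))\<^sup>2 * \<omega> z)"
      using \<omega>(2) by (auto simp: abs_mult intro!: mult_right_mono)
  qed measurable
  then show ?thesis by (simp add: L2w_def)
qed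

text \<open>Cauchy-Schwarz for the factors \<open>F y * y powr (\<alpha> / 2)\<close> and
  \<open>y powr (- \<alpha> / 2)\<close>. The constant is the integral of
  \<open>y powr (- \<alpha>)\<close> over [0, 2].\<close>

lemma weighted_Cauchy_Schwarz_line:
  fixes F :: "real \<Rightarrow> real"
  assumes \<alpha>: "\<alpha> < 1" and [measurable]: "F \<in> borel_measurable borel" and F: "\<And>y. 0 \<le> F y"
  shows "(\<integral>\<^sup>+y. ennreal (F y) * indicator {0..2} y \<partial>lborel)\<^sup>2
    \<le> ennreal (2 powr (1 - \<alpha>) / (1 - \<alpha>)) * (\<integral>\<^sup>+y. ennreal ((F y)\<^sup>2 * y powr \<alpha>) \<partial>lborel)"
proof -
  have split: "(\<integral>\<^sup>+y. ennreal (F y) * indicator {0..2} y \<partial>lborel)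
    = (\<integral>\<^sup>+y. ennreal (F y * y powr (\<alpha> / 2)) * (ennreal (y powr (- \<alpha> / 2)) * indicator {0..2} y) \<partial>lborel)"
  proof (rule nn_integral_cong_AE)
    show "AE y in lborel. ennreal (F y) * indicator {0..2} y
      = ennreal (F y * y powr (\<alpha> / 2)) * (ennreal (y powr (- \<alpha> / 2)) * indicator {0..2} y)"
      \<comment> \<open>At y = 0 every power is 0 by convention, so the factorisation is claimed
        only off that point.\<close>
      using AE_lborel_singleton[of "0 :: real"]
    proof eventually_elim
      case (elim y)
      show ?case
      proof (cases "y \<in> {0..2}")
        case True
        with elim have "F y = (F y * y powr (\<alpha> / 2)) * y powr (- \<alpha> / 2)"
          by (simp add: mult.assoc powr_add[symmetric])
        with True show ?thesis
          using F[of y] by (simp add: ennreal_mult[symmetric])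
      qed simp
    qed
  qed
  have F2: "(\<integral>\<^sup>+y. (ennreal (F y * y powr (\<alpha> / 2)))\<^sup>2 \<partial>lborel) = (\<integral>\<^sup>+y. ennreal ((F y)\<^sup>2 * y powr \<alpha>) \<partial>lborel)"
  proof (rule nn_integral_cong)
    fix y :: real
    have "(F y * y powr (\<alpha> / 2))\<^sup>2 = (F y)\<^sup>2 * y powr \<alpha>"
      by (simp add: power_mult_distrib power2_eq_square[of "y powr _"] powr_add[symmetric])
    then show "(ennreal (F y * y powr (\<alpha> / 2)))\<^sup>2 = ennreal ((F y)\<^sup>2 * y powr \<alpha>)"
      using F[of y] by (simp add: ennreal_power)
  qed
  have "(\<integral>\<^sup>+y. (ennreal (y powr (- \<alpha> / 2)) * indicator {0..2} y)\<^sup>2 \<partial>lborel)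
    = (\<integral>\<^sup>+y. ennreal (y powr (- \<alpha>)) * indicator {0..2} y \<partial>lborel)"
  proof (rule nn_integral_cong)
    fix y :: real
    have "(y powr (- \<alpha> / 2))\<^sup>2 = y powr (- \<alpha>)"
      by (simp add: power2_eq_square powr_add[symmetric])
    then have "(ennreal (y powr (- \<alpha> / 2)))\<^sup>2 = ennreal (y powr (- \<alpha>))"
      by (simp add: ennreal_power)
    then show "(ennreal (y powr (- \<alpha> / 2)) * indicator {0..2} y)\<^sup>2 = ennreal (y powr (- \<alpha>)) * indicator {0..2} y"
      by (simp add: indicator_def)
  qed
  also have "\<dots> = ennreal (2 powr (- \<alpha> + 1) / (- \<alpha> + 1))"
    by (rule nn_integral_has_integral_lebesgue'[OF _ has_integral_powr_from_0]) (use \<alpha> in auto)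
  finally have c: "(\<integral>\<^sup>+y. (ennreal (y powr (- \<alpha> / 2)) * indicator {0..2} y)\<^sup>2 \<partial>lborel)
    = ennreal (2 powr (1 - \<alpha>) / (1 - \<alpha>))"
    by simp
  show ?thesis
    unfolding split F2[symmetric] c[symmetric]
    by (subst mult.commute, rule Cauchy_Schwarz_nn_integral) measurable
qed

text \<open>Squaring the bound on a line and applying the weighted Cauchy-Schwarz inequality bounds
  the squared trace by \<open>B x\<close>. Integrated over x, this is a constant times the weighted
  integral of \<open>F\<close> squared, which is finite because \<open>v\<close> and its weak
  y-derivative lie in the weighted space.\<close>

lemma tr_in_L2:
  fixes \<Omega> :: "'a::euclidean_space set"
  assumes v: "v \<in> H1b \<alpha> \<Omega>" and \<Omega>: "open \<Omega>" and \<alpha>: "\<alpha> < 1"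
  shows "tr \<Omega> v \<in> L2w (\<lambda>_. 1) \<Omega>"
proof -
  let ?D = "half_cylinder \<Omega>"
  note D = open_half_cylinder[OF \<Omega>] lebesgue_open[OF open_half_cylinder[OF \<Omega>]]
  have vH: "v \<in> H1w (ypow \<alpha>) ?D" using v by (simp add: H1b_def)
  define G where "G = weak_gradient ?D v"
  note G = H1w_weak_gradient[OF vH D(1) ypow_measurable_lebesgue_on, folded G_def]
  have vL: "v \<in> L2w (ypow \<alpha>) ?D" using vH by (simp add: H1w_def)
  have gL: "(\<lambda>z. G z \<bullet> (0, 1)) \<in> L2w (ypow \<alpha>) ?D"
    by (rule L2w_component[OF G(2) _ ypow_measurable_lebesgue_on ypow_nonneg]) (auto simp: Basis_prod_def)
  obtain v' where v': "v' \<in> borel_measurable borel" "AE z in lborel. (if z \<in> ?D then v z else 0) = v' z"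
    using borel_measurable_representative[OF D(2)] vL unfolding L2w_def by blast
  obtain g' where g': "g' \<in> borel_measurable borel" "AE z in lborel. (if z \<in> ?D then G z \<bullet> (0, 1) else 0) = g' z"
    using borel_measurable_representative[OF D(2)] gL unfolding L2w_def by blast
  have [measurable]: "v' \<in> borel_measurable (borel \<Otimes>\<^sub>M borel)" "g' \<in> borel_measurable (borel \<Otimes>\<^sub>M borel)"
    using v'(1) g'(1) by (simp_all add: borel_prod)
  obtain w where w: "vertical_rep \<Omega> v w" "tr \<Omega> v = (\<lambda>x. w (x, 0))" by (rule H1b_vertical_rep[OF v])
  obtain M where M: "M > 0" "\<And>x. \<bar>smooth_step_deriv x\<bar> \<le> M"
    by (rule smooth_step_deriv_bounded) (rule that)
  define F where "F z = M * \<bar>v' z\<bar> + \<bar>g' z\<bar>" for z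
  have F_nonneg: "0 \<le> F z" for z using M(1) by (simp add: F_def)
  have F_meas [measurable]: "F \<in> borel_measurable (borel \<Otimes>\<^sub>M borel)"
    unfolding F_def[abs_def] by measurable
  define c where "c = 2 powr (1 - \<alpha>) / (1 - \<alpha>)"
  define B where "B x = ennreal c * (\<integral>\<^sup>+y. ennreal ((F (x, y))\<^sup>2 * y powr \<alpha>) \<partial>lborel)" for x
  have B_meas [measurable]: "B \<in> borel_measurable borel"
    unfolding B_def[abs_def] by measurable
  \<comment> \<open>One null set of x serves all n, since there are countably many.\<close>
  have "AE x in lebesgue_on \<Omega>. \<forall>n. n \<ge> 2 \<longrightarrow>
      (\<integral>y. v' (x, y) * (trace_kernel n y - trace_kernel 1 y) + g' (x, y) * trace_cutoff n y \<partial>lborel) = 0"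
    unfolding AE_all_countable
    using AE_vertical_integration_by_parts[OF \<Omega> G(1) v' g'] by auto
  then have "AE x in lborel. x \<in> \<Omega> \<longrightarrow> (\<forall>n. n \<ge> 2 \<longrightarrow>
      (\<integral>y. v' (x, y) * (trace_kernel n y - trace_kernel 1 y) + g' (x, y) * trace_cutoff n y \<partial>lborel) = 0)"
    unfolding AE_lebesgue_on_iff[OF lebesgue_open[OF \<Omega>]] .
  then have bound: "AE x in lborel. x \<in> \<Omega> \<longrightarrow> ennreal ((tr \<Omega> v x)\<^sup>2) \<le> B x"
    using vertical_rep_AE_lines[OF \<Omega> w(1) v'(2)]
  proof eventually_elim
    case (elim x)
    show ?case
    proof
      assume x: "x \<in> \<Omega>"
      have "ennreal \<bar>w (x, 0)\<bar> \<le> (\<integral>\<^sup>+y. ennreal (F (x, y)) * indicator {0..2} y \<partial>lborel)"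
        unfolding F_def
        by (rule trace_line_bound[OF M(2), of "\<lambda>y. w (x, y)" "\<lambda>y. v' (x, y)" "\<lambda>y. g' (x, y)"])
          (use elim x borel_measurable_section v'(1) g'(1) in auto)
      then have "(ennreal \<bar>w (x, 0)\<bar>)\<^sup>2 \<le> (\<integral>\<^sup>+y. ennreal (F (x, y)) * indicator {0..2} y \<partial>lborel)\<^sup>2"
        by (rule power_mono) simp
      also have "\<dots> \<le> B x"
        unfolding B_def c_def
        by (rule weighted_Cauchy_Schwarz_line[OF \<alpha>]) (auto simp: F_nonneg)
      finally show "ennreal ((tr \<Omega> v x)\<^sup>2) \<le> B x"
        by (simp add: w(2) ennreal_power)
    qed
  qed
  have int: "integrable lborel (\<lambda>z. 2 * M\<^sup>2 * ((v' z)\<^sup>2 * ypow \<alpha> z) + 2 * ((g' z)\<^sup>2 * ypow \<alpha> z))"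
    using L2w_representative_integrable[OF vL D(2) v'] L2w_representative_integrable[OF gL D(2) g']
    by (intro Bochner_Integration.integrable_add integrable_mult_right)
  have "(\<integral>\<^sup>+x. B x \<partial>lborel) = ennreal c * (\<integral>\<^sup>+x. (\<integral>\<^sup>+y. ennreal ((F (x, y))\<^sup>2 * y powr \<alpha>) \<partial>lborel) \<partial>lborel)"
    unfolding B_def by (rule nn_integral_cmult) measurable
  also have "\<dots> = ennreal c * (\<integral>\<^sup>+z. ennreal ((F z)\<^sup>2 * ypow \<alpha> z) \<partial>lborel)"
  proof -
    have "(\<lambda>z. ennreal ((F z)\<^sup>2 * ypow \<alpha> z)) \<in> borel_measurable (lborel \<Otimes>\<^sub>M lborel)"
      unfolding lborel_prod using F_meas[unfolded borel_prod] by measurable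
    from sigma_finite_measure.nn_integral_fst[OF sigma_finite_lborel this] show ?thesis
      by (simp add: ypow_def lborel_prod)
  qed
  also have "\<dots> < \<infinity>"
  proof -
    have "(\<integral>\<^sup>+z. ennreal ((F z)\<^sup>2 * ypow \<alpha> z) \<partial>lborel)
      \<le> (\<integral>\<^sup>+z. ennreal (2 * M\<^sup>2 * ((v' z)\<^sup>2 * ypow \<alpha> z) + 2 * ((g' z)\<^sup>2 * ypow \<alpha> z)) \<partial>lborel)"
    proof (intro nn_integral_mono ennreal_leI)
      fix z
      \<comment> \<open>This is (a + b)^2 \<le> 2 a^2 + 2 b^2.\<close>
      have "(F z)\<^sup>2 \<le> 2 * M\<^sup>2 * (v' z)\<^sup>2 + 2 * (g' z)\<^sup>2"
        using sum_squares_bound[of "M * \<bar>v' z\<bar>" "\<bar>g' z\<bar>"]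
        by (simp add: F_def power2_sum power_mult_distrib)
      from mult_right_mono[OF this ypow_nonneg]
      show "(F z)\<^sup>2 * ypow \<alpha> z \<le> 2 * M\<^sup>2 * ((v' z)\<^sup>2 * ypow \<alpha> z) + 2 * ((g' z)\<^sup>2 * ypow \<alpha> z)"
        by (simp add: algebra_simps)
    qed
    also have "\<dots> < \<infinity>"
      using int by (subst nn_integral_eq_integral) (auto simp: ypow_nonneg)
    finally show ?thesis
      by (simp add: ennreal_mult_less_top)
  qed
  finally have fin: "(\<integral>\<^sup>+x. B x \<partial>lborel) < \<infinity>" .
  note m = tr_measurable[OF v \<Omega>]
  have "integrable (lebesgue_on \<Omega>) (\<lambda>x. (norm (tr \<Omega> v x))\<^sup>2 * 1)"
  proof (rule integrableI_bounded)
    show "(\<lambda>x. (norm (tr \<Omega> v x))\<^sup>2 * 1) \<in> borel_measurable (lebesgue_on \<Omega>)"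
      using m by measurable
    have "(\<integral>\<^sup>+x. ennreal (norm ((norm (tr \<Omega> v x))\<^sup>2 * 1)) \<partial>lebesgue_on \<Omega>)
      = (\<integral>\<^sup>+x. ennreal ((tr \<Omega> v x)\<^sup>2) * indicator \<Omega> x \<partial>lebesgue)"
      using lebesgue_open[OF \<Omega>] by (simp add: nn_integral_restrict_space)
    also have "\<dots> \<le> (\<integral>\<^sup>+x. B x \<partial>lebesgue)"
      using AE_completion[OF bound]
      by (intro nn_integral_mono_AE) (auto simp: indicator_def elim!: eventually_mono)
    also have "\<dots> = (\<integral>\<^sup>+x. B x \<partial>lborel)"
      by (rule nn_integral_completion) 
    finally show "(\<integral>\<^sup>+x. ennreal (norm ((norm (tr \<Omega> v x))\<^sup>2 * 1)) \<partial>lebesgue_on \<Omega>) < \<infinity>"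
      using fin by simp
  qed
  with m show ?thesis by (simp add: L2w_def)
qed

section \<open>The energy\<close>

lemma innerw_tr_add_mult:
  assumes f: "f \<in> L2w (\<lambda>_. 1) \<Omega>" and v: "v \<in> H1b \<alpha> \<Omega>" and w: "w \<in> H1b \<alpha> \<Omega>"
    and \<Omega>: "open \<Omega>" and \<alpha>: "\<alpha> < 1"
  shows "innerw (\<lambda>_. 1) \<Omega> f (tr \<Omega> (\<lambda>z. v z + t * w z))
    = innerw (\<lambda>_. 1) \<Omega> f (tr \<Omega> v) + t * innerw (\<lambda>_. 1) \<Omega> f (tr \<Omega> w)"
proof -
  note L = tr_in_L2[OF v \<Omega> \<alpha>] tr_in_L2[OF w \<Omega> \<alpha>] tr_in_L2[OF H1b_add_mult[OF v w \<Omega>] \<Omega> \<alpha>]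
  have "innerw (\<lambda>_. 1) \<Omega> f (tr \<Omega> (\<lambda>z. v z + t * w z))
    = innerw (\<lambda>_. 1) \<Omega> f (\<lambda>x. tr \<Omega> v x + t *\<^sub>R tr \<Omega> w x)"
    by (rule innerw_cong_AE[OF f f L(3) L2w_add_scaleR[OF L(1,2)]])
      (use tr_add_mult[OF v w \<Omega>] in auto)
  also have "\<dots> = innerw (\<lambda>_. 1) \<Omega> f (tr \<Omega> v) + t * innerw (\<lambda>_. 1) \<Omega> f (tr \<Omega> w)"
    using L2w_integrable_inner[OF f L(1)] L2w_integrable_inner[OF f L(2)]
    by (simp add: innerw_def distrib_left mult.left_commute)
  finally show ?thesis .
qed

lemma linear_coefficient_zero:
  fixes a b :: real
  assumes "\<And>t. 0 \<le> a * t + b * t\<^sup>2"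
  shows "a = 0"
proof (rule ccontr)
  assume "a \<noteq> 0"
  \<comment> \<open>The minimiser of \<open>a * t + (\<bar>b\<bar> + 1) * t\<^sup>2\<close>. Adding
    1 keeps the denominator positive when \<open>b\<close> is 0.\<close>
  define t where "t = - a / (2 * (\<bar>b\<bar> + 1))"
  have "a * t + b * t\<^sup>2 \<le> a * t + (\<bar>b\<bar> + 1) * t\<^sup>2"
    by (intro add_left_mono mult_right_mono) auto
  also have "\<dots> = - (a\<^sup>2 / (4 * (\<bar>b\<bar> + 1)))"
    by (simp add: t_def field_simps power2_eq_square add_nonneg_eq_0_iff)
  also have "\<dots> < 0" using \<open>a \<noteq> 0\<close> by (simp add: divide_pos_pos)
  finally show False using assms[of t] by simp
qed

theorem theorem2p1:
  fixes \<Omega> :: "'a::euclidean_space set" and s :: real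
    and f :: "'a \<Rightarrow> real" and u :: "'a \<times> real \<Rightarrow> real"
  assumes "bounded_lipschitz_domain \<Omega>"
    and "0 < s" and "s < 1"
    and "f \<in> L2w (\<lambda>_. 1) \<Omega>"
    and "u \<in> H1b (1 - 2 * s) \<Omega>"
  shows "(solves_P s \<Omega> f u \<longrightarrow> is_arg_min (energy s \<Omega> f) (\<lambda>w. w \<in> H1b (1 - 2 * s) \<Omega>) u) \<and>
         (is_arg_min (energy s \<Omega> f) (\<lambda>w. w \<in> H1b (1 - 2 * s) \<Omega>) u \<longrightarrow> solves_P s \<Omega> f u)"
proof -
  have \<Omega>: "open \<Omega>" using assms(1) by (simp add: bounded_lipschitz_domain_def)
  have \<alpha>: "1 - 2 * s < 1" using assms(2) by simp
  note u = assms(5)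
  define a where "a = grad_form (1 - 2 * s) \<Omega>"
  define L where "L w = d_const s * innerw (\<lambda>_. 1) \<Omega> f (tr \<Omega> w)" for w
  have E: "energy s \<Omega> f (\<lambda>z. u z + t * w z) = energy s \<Omega> f u + (a u w - L w) * t + (a w w / 2) * t\<^sup>2"
    if w: "w \<in> H1b (1 - 2 * s) \<Omega>" for w t
    unfolding energy_def a_def L_def grad_form_add_mult[OF u w \<Omega>]
      innerw_tr_add_mult[OF assms(4) u w \<Omega> \<alpha>]
    by (simp add: field_simps)
  have "energy s \<Omega> f u \<le> energy s \<Omega> f w" if P: "solves_P s \<Omega> f u" and w: "w \<in> H1b (1 - 2 * s) \<Omega>" for w
  proof -
    \<comment> \<open>The direction from \<open>u\<close> to \<open>w\<close>, so that t = 1 in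
      \<open>E\<close> gives the energy of \<open>w\<close>. The weak equation removes the linear
      term.\<close>
    define h where "h z = w z + (- 1) * u z" for z
    have h: "h \<in> H1b (1 - 2 * s) \<Omega>"
      unfolding h_def[abs_def] by (rule H1b_add_mult[OF w u \<Omega>])
    have "energy s \<Omega> f w = energy s \<Omega> f u + a h h / 2"
      using E[OF h, of 1] P h by (simp add: h_def[abs_def] solves_P_def a_def L_def)
    then show ?thesis
      using grad_form_nonneg[of "1 - 2 * s" \<Omega> h] by (simp add: a_def)
  qed
  moreover have "a u w = L w"
    if min: "is_arg_min (energy s \<Omega> f) (\<lambda>w. w \<in> H1b (1 - 2 * s) \<Omega>) u" and w: "w \<in> H1b (1 - 2 * s) \<Omega>" for w
  proof -
    \<comment> \<open>Every \<open>u + t w\<close> is an admissible competitor, for t of either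
      sign.\<close>
    have "0 \<le> (a u w - L w) * t + (a w w / 2) * t\<^sup>2" for t
      using min H1b_add_mult[OF u w \<Omega>, of t] E[OF w, of t] by (force simp: is_arg_min_def not_less)
    then show ?thesis using linear_coefficient_zero[of "a u w - L w" "a w w / 2"] by simp
  qed
  ultimately show ?thesis
    using u by (auto simp: is_arg_min_def solves_P_def not_less a_def L_def)
qed

end
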